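(* Suppose $q^{2k}\neq 1$. Consider the set $\mathcal{B}'$ of monomials \[ \prod_{a=1}^n \psi_a^{p_a}(\psi_a^* )^{d_a}\omega_a^{v_a}\qquad(\text{factors in the order } a=1,\dots,n), \] with $p_a,d_a\in\{0,1\}$ and $v_a\in\{0,1,\dots,4k-1\}$, satisfying for every $a$: (1) $p_a+d_a<2$, and (2) $v_a\le 2k-1$ if $p_a+d_a=1$. Then $\mathcal{B}'$ is a $\mathbb{k}$-basis of $\mathrm{Cl}_q(n,k)$.
   Context: Let $\mathbb{k}$ be a field of characteristic different from $2$, let $q\in\mathbb{k}^\times$, and let $n,k$ be positive integers. The quantum Clifford algebra $\mathrm{Cl}_q(n,k)$ is the unital associative $\mathbb{k}$-algebra generated by $\psi_a,\psi_a^*,\omega_a,\omega_a^{-1}$ for $a\in\{1,\dots,n\}$, subject to the relations (for all $a,b\in\{1,\dots,n\}$): $\omega_a\omega_b=\omega_b\omega_a$; $\omega_a\omega_a^{-1}=1$; $\omega_a\psi_b=q^{\delta_{ab}}\psi_b\omega_a$; $\omega_a\psi_b^*=q^{-\delta_{ab}}\psi_b^*\omega_a$; $\psi_a\psi_b+\psi_b\psi_a=0$; $\psi_a^*\psi_b^*+\psi_b^*\psi_a^*=0$; $\psi_a\psi_a^*+q^k\psi_a^*\psi_a=\omega_a^{-k}$; $\psi_a\psi_a^*+q^{-k}\psi_a^*\psi_a=\omega_a^{k}$; and $\psi_a\psi_b^*+\psi_b^*\psi_a=0$ if $a\neq b$. *)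

theory Defs
  imports Main
begin

datatype gen = Psi nat | PsiS nat | Om nat | OmI nat

fun gidx :: "gen \<Rightarrow> nat" where
  "gidx (Psi a) = a" | "gidx (PsiS a) = a" | "gidx (Om a) = a" | "gidx (OmI a) = a"

definition valid_word :: "nat \<Rightarrow> gen list \<Rightarrow> bool" where
  "valid_word n w \<longleftrightarrow> (\<forall>x\<in>set w. gidx x \<in> {1..n})"

definition free_alg :: "nat \<Rightarrow> (gen list \<Rightarrow> 'k::field) set" where
  "free_alg n = {f. finite {w. f w \<noteq> 0} \<and> (\<forall>w. f w \<noteq> 0 \<longrightarrow> valid_word n w)}"

definition fa_word :: "gen list \<Rightarrow> gen list \<Rightarrow> 'k::field" where
  "fa_word u = (\<lambda>w. if w = u then 1 else 0)"

definition fa_add :: "(gen list \<Rightarrow> 'k::field) \<Rightarrow> (gen list \<Rightarrow> 'k) \<Rightarrow> gen list \<Rightarrow> 'k" where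
  "fa_add f g = (\<lambda>w. f w + g w)"

definition fa_smul :: "'k::field \<Rightarrow> (gen list \<Rightarrow> 'k) \<Rightarrow> gen list \<Rightarrow> 'k" where
  "fa_smul c f = (\<lambda>w. c * f w)"

definition fa_mul :: "(gen list \<Rightarrow> 'k::field) \<Rightarrow> (gen list \<Rightarrow> 'k) \<Rightarrow> gen list \<Rightarrow> 'k" where
  "fa_mul f g = (\<lambda>w. \<Sum>i\<in>{0..length w}. f (take i w) * g (drop i w))"

definition lc :: "('k::field \<times> gen list) list \<Rightarrow> gen list \<Rightarrow> 'k" where
  "lc xs = (\<lambda>w. sum_list (map (\<lambda>(c,u). if u = w then c else 0) xs))"

text \<open>Defining relations of Cl_q(n,k), each written as an element r meaning r = 0.\<close>
definition cl_rels :: "nat \<Rightarrow> nat \<Rightarrow> 'k::field \<Rightarrow> (gen list \<Rightarrow> 'k) set" where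
  "cl_rels n k q =
     (\<Union>a\<in>{1..n}. \<Union>b\<in>{1..n}.
       { lc [(1, [Om a, Om b]), (-1, [Om b, Om a])],
         lc [(1, [Om a, Psi b]), (- (if a = b then q else 1), [Psi b, Om a])],
         lc [(1, [Om a, PsiS b]), (- (if a = b then inverse q else 1), [PsiS b, Om a])],
         lc [(1, [Psi a, Psi b]), (1, [Psi b, Psi a])],
         lc [(1, [PsiS a, PsiS b]), (1, [PsiS b, PsiS a])] }
       \<union> (if a \<noteq> b then {lc [(1, [Psi a, PsiS b]), (1, [PsiS b, Psi a])]} else {}))
   \<union> (\<Union>a\<in>{1..n}.
       { lc [(1, [Om a, OmI a]), (-1, [])],
         lc [(1, [OmI a, Om a]), (-1, [])],
         lc [(1, [Psi a, PsiS a]), (q ^ k, [PsiS a, Psi a]), (-1, replicate k (OmI a))],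
         lc [(1, [Psi a, PsiS a]), (inverse q ^ k, [PsiS a, Psi a]), (-1, replicate k (Om a))] })"

inductive_set cl_ideal :: "nat \<Rightarrow> nat \<Rightarrow> 'k::field \<Rightarrow> (gen list \<Rightarrow> 'k) set"
  for n k :: nat and q :: "'k::field" where
  zero: "(\<lambda>_. 0) \<in> cl_ideal n k q"
| gen: "r \<in> cl_rels n k q \<Longrightarrow> valid_word n u \<Longrightarrow> valid_word n v \<Longrightarrow>
          fa_mul (fa_mul (fa_word u) r) (fa_word v) \<in> cl_ideal n k q"
| add: "f \<in> cl_ideal n k q \<Longrightarrow> g \<in> cl_ideal n k q \<Longrightarrow> fa_add f g \<in> cl_ideal n k q"
| smul: "f \<in> cl_ideal n k q \<Longrightarrow> fa_smul c f \<in> cl_ideal n k q"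

definition mono_word :: "nat \<Rightarrow> (nat \<Rightarrow> nat) \<Rightarrow> (nat \<Rightarrow> nat) \<Rightarrow> (nat \<Rightarrow> nat) \<Rightarrow> gen list" where
  "mono_word n p d v =
     concat (map (\<lambda>a. replicate (p a) (Psi a) @ replicate (d a) (PsiS a) @ replicate (v a) (Om a)) [1..<n+1])"

definition basis_idx :: "nat \<Rightarrow> nat \<Rightarrow> ((nat \<Rightarrow> nat) \<times> (nat \<Rightarrow> nat) \<times> (nat \<Rightarrow> nat)) set" where
  "basis_idx n k = {(p, d, v).
      (\<forall>a. a \<notin> {1..n} \<longrightarrow> p a = 0 \<and> d a = 0 \<and> v a = 0) \<and>
      (\<forall>a\<in>{1..n}. p a \<in> {0,1} \<and> d a \<in> {0,1} \<and> v a \<in> {0..<4*k} \<and>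
         p a + d a < 2 \<and> (p a + d a = 1 \<longrightarrow> v a \<le> 2*k - 1))}"

end

theory Submission
  imports Defs "HOL.Vector_Spaces" "HOL-Library.Function_Algebras"
begin

text \<open>
  Spanning is proved dually: if some element were not a combination of the monomials modulo the
  ideal, a linear functional would separate it. Such a functional satisfies the defining relations
  inside every word, and solving the two quadratic relations for \<open>\<psi>\<^sub>a \<psi>\<^sub>a\<^sup>*\<close> and \<open>\<psi>\<^sub>a\<^sup>* \<psi>\<^sub>a\<close>
  (possible since \<open>q\<^sup>2\<^sup>k \<noteq> 1\<close>) gives
  \<open>\<psi>\<^sub>a \<omega>\<^sub>a\<^sup>2\<^sup>k = q\<^sup>-\<^sup>2\<^sup>k \<psi>\<^sub>a\<close>, \<open>\<psi>\<^sub>a\<^sup>* \<omega>\<^sub>a\<^sup>2\<^sup>k = \<psi>\<^sub>a\<^sup>*\<close> and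
  \<open>(\<omega>\<^sub>a\<^sup>2\<^sup>k - 1)(q\<^sup>2\<^sup>k \<omega>\<^sub>a\<^sup>2\<^sup>k - 1) = 0\<close>. These reduce every word to the monomials, on
  which the functional vanishes.

  Independence comes from a monomial representation. For one site take a free module of rank two
  over \<open>k[x]/(x\<^sup>2\<^sup>k - 1)\<close>, with \<open>\<omega>\<close> acting as \<open>x\<close> on the occupied and as \<open>q\<^sup>-\<^sup>1 x\<close> on the
  empty vector, \<open>\<psi>\<close> and \<open>\<psi>\<^sup>*\<close> exchanging the two (the latter with a factor \<open>x\<^sup>k\<close>); several
  sites are combined with the usual fermionic signs. Matrix coefficients determine all data of a
  monomial except whether \<open>v\<^sub>a < 2k\<close> at the sites carrying neither \<open>\<psi>\<^sub>a\<close>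
  nor \<open>\<psi>\<^sub>a\<^sup>*\<close>, and there \<open>\<omega>\<^sub>a\<^sup>2\<^sup>k\<close> has
  the two distinct eigenvalues \<open>1\<close> and \<open>q\<^sup>-\<^sup>2\<^sup>k\<close>, so the coefficients are those of a
  multilinear polynomial vanishing on a grid.
\<close>

subsection \<open>Functionals on the free algebra\<close>

text \<open>The linear extension of \<open>\<phi>\<close> from words to finite combinations of
  words. Only the support of \<open>f\<close> is summed over, so \<open>\<phi>\<close> may be
  nonzero on infinitely many words.\<close>

definition pairing :: "(gen list \<Rightarrow> 'k::field) \<Rightarrow> (gen list \<Rightarrow> 'k) \<Rightarrow> 'k" where
  "pairing f \<phi> = (\<Sum>w | f w \<noteq> 0. f w * \<phi> w)"

lemma pairing_superset:
  assumes "finite A" "{w. f w \<noteq> 0} \<subseteq> A"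
  shows "pairing f \<phi> = (\<Sum>w\<in>A. f w * \<phi> w)"
  unfolding pairing_def by (rule sum.mono_neutral_left) (use assms in auto)

lemma pairing_add:
  assumes "finite {w. f w \<noteq> 0}" "finite {w. g w \<noteq> 0}"
  shows "pairing (fa_add f g) \<phi> = pairing f \<phi> + pairing g \<phi>"
proof -
  let ?A = "{w. f w \<noteq> 0} \<union> {w. g w \<noteq> 0}"
  have "pairing (fa_add f g) \<phi> = (\<Sum>w\<in>?A. fa_add f g w * \<phi> w)"
    by (rule pairing_superset) (use assms in \<open>auto simp: fa_add_def\<close>)
  also have "\<dots> = (\<Sum>w\<in>?A. f w * \<phi> w) + (\<Sum>w\<in>?A. g w * \<phi> w)"
    by (simp add: fa_add_def distrib_right sum.distrib)
  also have "\<dots> = pairing f \<phi> + pairing g \<phi>"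
    using assms by (simp add: pairing_superset[of ?A])
  finally show ?thesis .
qed

lemma finite_support_smul:
  assumes "finite {w. f w \<noteq> 0}"
  shows "finite {w. fa_smul c f w \<noteq> 0}"
  by (rule finite_subset[OF _ assms]) (auto simp: fa_smul_def)

lemma finite_support_add:
  assumes "finite {w. f w \<noteq> 0}" "finite {w. g w \<noteq> 0}"
  shows "finite {w. fa_add f g w \<noteq> 0}"
  by (rule finite_subset[of _ "{w. f w \<noteq> 0} \<union> {w. g w \<noteq> 0}"]) (use assms in \<open>auto simp: fa_add_def\<close>)

lemma pairing_smul:
  assumes "finite {w. f w \<noteq> 0}"
  shows "pairing (fa_smul c f) \<phi> = c * pairing f \<phi>"
proof -
  have "pairing (fa_smul c f) \<phi> = (\<Sum>w | f w \<noteq> 0. fa_smul c f w * \<phi> w)"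
    by (rule pairing_superset) (use assms in \<open>auto simp: fa_smul_def\<close>)
  then show ?thesis
    by (simp add: pairing_def fa_smul_def sum_distrib_left mult.assoc)
qed

lemma lc_Nil: "lc [] = (\<lambda>_. 0)"
  by (simp add: lc_def)

lemma lc_Cons: "lc ((c, u) # xs) = fa_add (fa_smul c (fa_word u)) (lc xs)"
  by (auto simp: lc_def fa_add_def fa_smul_def fa_word_def fun_eq_iff)

lemma finite_support_word: "finite {w. fa_word u w \<noteq> (0::'k::field)}"
  by (simp add: fa_word_def)

lemma finite_support_lc: "finite {w. lc xs w \<noteq> 0}"
  by (induction xs)
    (auto simp: lc_Nil lc_Cons intro!: finite_support_add finite_support_smul finite_support_word)

lemma pairing_word: "pairing (fa_word u) \<phi> = \<phi> u"
  by (simp add: pairing_def fa_word_def)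

lemma pairing_lc: "pairing (lc xs) \<phi> = (\<Sum>(c, w)\<leftarrow>xs. c * \<phi> w)"
  by (induction xs)
    (auto simp: lc_Nil lc_Cons pairing_add pairing_smul pairing_word finite_support_lc
      finite_support_smul finite_support_word, simp add: pairing_def)

section \<open>Two-sided multiplication by words\<close>

lemma fa_mul_word_left:
  "fa_mul (fa_word u) f x = (if take (length u) x = u then f (drop (length u) x) else 0)"
proof -
  have "fa_mul (fa_word u) f x = (\<Sum>i\<in>{0..length x}. if i = length u then
      (if take (length u) x = u then f (drop (length u) x) else 0) else 0)"
    unfolding fa_mul_def fa_word_def by (rule sum.cong) auto
  also have "\<dots> = (if take (length u) x = u then f (drop (length u) x) else 0)"
    by (auto dest: arg_cong[where f = length])
  finally show ?thesis .
qed

text \<open>Only the cut at \<open>length x - length v\<close> can leave the suffix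
  \<open>v\<close>. If \<open>x\<close> is shorter than \<open>v\<close>, the truncated difference
  is 0 and the test fails because \<open>x\<close> itself is too short.\<close>

lemma fa_mul_word_right:
  "fa_mul f (fa_word v) x =
    (if drop (length x - length v) x = v then f (take (length x - length v) x) else 0)"
proof -
  have "fa_mul f (fa_word v) x = (\<Sum>i\<in>{0..length x}. if i = length x - length v then
      (if drop (length x - length v) x = v then f (take (length x - length v) x) else 0) else 0)"
    unfolding fa_mul_def fa_word_def
  proof (rule sum.cong)
    fix i assume "i \<in> {0..length x}"
    then have "i = length x - length v" if "drop i x = v" using that by auto
    then show "f (take i x) * (if drop i x = v then 1 else 0) = (if i = length x - length v then
      (if drop (length x - length v) x = v then f (take (length x - length v) x) else 0) else 0)"
      by (cases "i = length x - length v") (simp, metis mult_zero_right)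
  qed simp
  then show ?thesis by simp
qed

lemma fa_mul_context:
  "fa_mul (fa_mul (fa_word u) f) (fa_word v) x = (if \<exists>w. x = u @ w @ v then f (drop (length u) (take (length x - length v) x)) else 0)"
proof -
  have "(drop (length x - length v) x = v \<and>
      take (length u) (take (length x - length v) x) = u) \<longleftrightarrow> (\<exists>w. x = u @ w @ v)" (is "?l \<longleftrightarrow> ?r")
  proof
    assume l: ?l
    define y where "y = take (length x - length v) x"
    have "x = y @ v" "y = u @ drop (length u) y"
      using l append_take_drop_id[of "length x - length v" x] append_take_drop_id[of "length u" y]
      by (auto simp: y_def)
    then show ?r by (metis append.assoc)
  qed auto
  then show ?thesis by (auto simp: fa_mul_word_left fa_mul_word_right)
qed

lemma context_support:
  "{x. fa_mul (fa_mul (fa_word u) f) (fa_word v) x \<noteq> 0} = (\<lambda>w. u @ w @ v) ` {w. f w \<noteq> 0}"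
  by (auto simp: fa_mul_context)

text \<open>Putting a word between \<open>u\<close> and \<open>v\<close> is injective, so
  coefficients are only relabelled and the context can be moved from \<open>f\<close> into
  \<open>\<phi>\<close>.\<close>

lemma pairing_context:
  "pairing (fa_mul (fa_mul (fa_word u) f) (fa_word v)) \<phi> = pairing f (\<lambda>w. \<phi> (u @ w @ v))"
proof -
  have "inj_on (\<lambda>w. u @ w @ v) {w. f w \<noteq> 0}"
    by (auto simp: inj_on_def)
  then show ?thesis
    unfolding pairing_def context_support by (subst sum.reindex) (auto simp: fa_mul_context)
qed

text \<open>The condition for \<open>\<phi>\<close> to induce a functional on the quotient algebra,
  with the context \<open>u\<close>, \<open>v\<close> placed in the argument of
  \<open>\<phi>\<close> so that each relation becomes an equation between values.\<close>

definition annihilates_rels :: "nat \<Rightarrow> nat \<Rightarrow> 'k::field \<Rightarrow> (gen list \<Rightarrow> 'k) \<Rightarrow> bool" where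
  "annihilates_rels n k q \<phi> \<longleftrightarrow> (\<forall>r\<in>cl_rels n k q. \<forall>u v. valid_word n u \<longrightarrow> valid_word n v \<longrightarrow>
     pairing r (\<lambda>w. \<phi> (u @ w @ v)) = 0)"

lemma cl_rels_lc: "cl_rels n k q \<subseteq> range lc"
  unfolding cl_rels_def by (intro UN_least Un_least) simp_all

lemma finite_support_context:
  assumes "finite {w. f w \<noteq> 0}"
  shows "finite {x. fa_mul (fa_mul (fa_word u) f) (fa_word v) x \<noteq> 0}"
  by (simp add: context_support assms)

text \<open>Finiteness of the support is carried through the induction because additivity of
  \<open>pairing\<close> relies on it.\<close>

lemma pairing_ideal:
  assumes "annihilates_rels n k q \<phi>" "f \<in> cl_ideal n k q"
  shows "finite {w. f w \<noteq> 0} \<and> pairing f \<phi> = 0"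
  using assms(2)
proof induction
  case zero
  show ?case by (simp add: pairing_def)
next
  case (gen r u v)
  obtain xs where "r = lc xs" using gen(1) cl_rels_lc by blast
  then have "finite {w. r w \<noteq> 0}" by (simp add: finite_support_lc)
  then show ?case
    using assms(1) gen by (simp add: annihilates_rels_def pairing_context finite_support_context)
next
  case (add f g)
  then show ?case by (simp add: pairing_add finite_support_add)
next
  case (smul f c)
  then show ?case by (simp add: pairing_smul finite_support_smul)
qed

section \<open>Linear functionals separating an element from a subspace\<close>

interpretation word_fun: vector_space "fa_smul :: 'k::field \<Rightarrow> (gen list \<Rightarrow> 'k) \<Rightarrow> gen list \<Rightarrow> 'k"
  by unfold_locales (auto simp: fa_smul_def fun_eq_iff algebra_simps)

lemma word_expansion:
  assumes "finite {w. f w \<noteq> 0}"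
  shows "f = (\<Sum>w | f w \<noteq> 0. fa_smul (f w) (fa_word w))"
proof
  fix x
  have sum_apply: "(\<Sum>w\<in>A. h w) x = (\<Sum>w\<in>A. h w x)"
    for A and h :: "gen list \<Rightarrow> gen list \<Rightarrow> 'a"
    by (induction A rule: infinite_finite_induct) auto
  show "f x = (\<Sum>w | f w \<noteq> 0. fa_smul (f w) (fa_word w)) x"
    using assms by (simp add: sum_apply fa_smul_def fa_word_def if_distrib[of "(*) _"] cong: if_cong)
qed

text \<open>\<open>L\<close> lives on all functions of words, where the words do not span; finite
  support is what makes \<open>f\<close> a combination of words.\<close>

lemma linear_eq_pairing:
  assumes "Vector_Spaces.linear fa_smul (*) L" "finite {w. f w \<noteq> 0}"
  shows "L f = pairing f (\<lambda>w. L (fa_word w))"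
proof -
  interpret L: Vector_Spaces.linear fa_smul "(*)" L by fact
  have "L f = L (\<Sum>w | f w \<noteq> 0. fa_smul (f w) (fa_word w))"
    by (rule arg_cong[OF word_expansion[OF assms(2)]])
  then show ?thesis by (simp add: L.sum L.scale pairing_def)
qed

text \<open>A basis of \<open>S\<close> stays independent after adding \<open>f\<close>, so the
  values 1 at \<open>f\<close> and 0 on the basis extend linearly.\<close>

lemma subspace_separation:
  fixes f :: "gen list \<Rightarrow> 'k::field"
  assumes "word_fun.subspace S" "f \<notin> S"
  shows "\<exists>L. Vector_Spaces.linear fa_smul (*) L \<and> (\<forall>g\<in>S. L g = 0) \<and> L f = (1::'k)"
proof -
  interpret word_fun_field: vector_space_pair
    "fa_smul :: 'k \<Rightarrow> (gen list \<Rightarrow> 'k) \<Rightarrow> gen list \<Rightarrow> 'k" "(*) :: 'k \<Rightarrow> 'k \<Rightarrow> 'k"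
    by unfold_locales (auto simp: algebra_simps)
  obtain B where B: "B \<subseteq> S" "word_fun.independent B" "S \<subseteq> word_fun.span B"
    using word_fun.maximal_independent_subset[of S] by auto
  have span: "word_fun.span B = S"
    using B word_fun.span_subspace[OF B(1) B(3) assms(1)] by simp
  have "word_fun.independent (insert f B)"
    using B(2) assms(2) span by (simp add: word_fun.independent_insertI)
  from word_fun_field.linear_independent_extend[OF this, of "\<lambda>g. if g = f then 1 else 0"]
  obtain L where L: "Vector_Spaces.linear fa_smul (*) L" "\<forall>x\<in>insert f B. L x = (if x = f then 1 else 0)"
    by auto
  have "L g = 0" if "g \<in> S" for g
  proof -
    have "\<forall>b\<in>B. L b = 0" using L(2) B(1) assms(2) by auto
    then show ?thesis
      using word_fun_field.linear_eq_0_on_span[OF L(1), of B g] that span by auto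
  qed
  with L show ?thesis by auto
qed

subsection \<open>Spanning\<close>

lemma valid_word_simps [simp]:
  "valid_word n []"
  "valid_word n (x # w) \<longleftrightarrow> gidx x \<in> {1..n} \<and> valid_word n w"
  "valid_word n (u @ v) \<longleftrightarrow> valid_word n u \<and> valid_word n v"
  by (auto simp: valid_word_def)

lemma valid_word_replicate [simp]: "gidx x \<in> {1..n} \<Longrightarrow> valid_word n (replicate m x)"
  by (auto simp: valid_word_def)

definition site_word :: "(nat \<Rightarrow> nat) \<Rightarrow> (nat \<Rightarrow> nat) \<Rightarrow> (nat \<Rightarrow> nat) \<Rightarrow> nat \<Rightarrow> gen list" where
  "site_word p d v a = replicate (p a) (Psi a) @ replicate (d a) (PsiS a) @ replicate (v a) (Om a)"

lemma mono_word_sites: "mono_word n p d v = concat (map (site_word p d v) [1..<n+1])"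
  unfolding mono_word_def site_word_def ..

text \<open>Exponents of \<open>\<omega>\<close> are unbounded here. Left multiplication by
  \<open>\<psi>\<close>, \<open>\<psi>\<^sup>*\<close> or \<open>\<omega>\<close> then stays within
  combinations of the family, and lowering exponents becomes a separate step.\<close>

definition ext_idx :: "nat \<Rightarrow> (nat \<Rightarrow> nat) \<Rightarrow> (nat \<Rightarrow> nat) \<Rightarrow> (nat \<Rightarrow> nat) \<Rightarrow> bool" where
  "ext_idx n p d v \<longleftrightarrow> (\<forall>a. a \<notin> {1..n} \<longrightarrow> p a = 0 \<and> d a = 0 \<and> v a = 0) \<and>
     (\<forall>a\<in>{1..n}. p a + d a < 2)"

definition kills_ext :: "nat \<Rightarrow> (gen list \<Rightarrow> 'k::field) \<Rightarrow> bool" where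
  "kills_ext n \<phi> \<longleftrightarrow> (\<forall>p d v. ext_idx n p d v \<longrightarrow> \<phi> (mono_word n p d v) = 0)"

text \<open>Isolates the block of site \<open>a\<close>. The same \<open>X\<close> and
  \<open>Y\<close> serve all \<open>i\<close>, \<open>j\<close>, \<open>m\<close>, so a rewriting of
  this block yields monomial words again.\<close>

lemma mono_word_split:
  assumes a: "a \<in> {1..n}"
  obtains X Y where "valid_word n X" "valid_word n Y" "\<forall>x\<in>set X. gidx x \<noteq> a \<and> (\<forall>b. x \<noteq> OmI b)"
    "\<And>i j m. mono_word n (p(a := i)) (d(a := j)) (v(a := m)) =
       X @ replicate i (Psi a) @ replicate j (PsiS a) @ replicate m (Om a) @ Y"
proof -
  define X where "X = concat (map (site_word p d v) [1..<a])"
  define Y where "Y = concat (map (site_word p d v) [Suc a..<n+1])"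
  have split: "[1..<n+1] = [1..<a] @ a # [Suc a..<n+1]"
    using a upt_add_eq_append[of 1 a "n + 1 - a"] upt_conv_Cons[of a "n+1"] by auto
  have site_cong: "map (site_word (p(a := i)) (d(a := j)) (v(a := m))) bs = map (site_word p d v) bs"
    if "a \<notin> set bs" for bs i j m
    using that by (induction bs) (auto simp: site_word_def)
  have "mono_word n (p(a := i)) (d(a := j)) (v(a := m)) =
       X @ replicate i (Psi a) @ replicate j (PsiS a) @ replicate m (Om a) @ Y" for i j m
    unfolding mono_word_sites split by (simp add: site_cong X_def Y_def) (simp add: site_word_def)
  moreover have "valid_word n X" "valid_word n Y" "\<forall>x\<in>set X. gidx x \<noteq> a \<and> (\<forall>b. x \<noteq> OmI b)"
    using a by (auto simp: X_def Y_def site_word_def valid_word_def)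
  ultimately show ?thesis using that by blast
qed

lemma ext_idx_basis:
  assumes "ext_idx n p d v" "k \<ge> 1" "(p, d, v) \<notin> basis_idx n k"
  shows "\<exists>a\<in>{1..n}. v a \<ge> 4*k \<or> (p a + d a = 1 \<and> v a \<ge> 2*k)"
proof (rule ccontr)
  assume small: "\<not> ?thesis"
  have "p a \<in> {0,1} \<and> d a \<in> {0,1} \<and> v a \<in> {0..<4*k} \<and>
         p a + d a < 2 \<and> (p a + d a = 1 \<longrightarrow> v a \<le> 2*k - 1)" if "a \<in> {1..n}" for a
  proof -
    have "v a < 4*k" "p a + d a < 2" "p a + d a = 1 \<longrightarrow> v a < 2*k"
      using small assms(1) that unfolding ext_idx_def by (meson not_le)+
    then show ?thesis by auto
  qed
  then show False using assms by (auto simp: basis_idx_def ext_idx_def)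
qed

section \<open>Defining relations as equations between values of a functional\<close>

locale clifford_functional =
  fixes n k :: nat and q :: "'k::field" and \<phi> :: "gen list \<Rightarrow> 'k"
  assumes two: "(2::'k) \<noteq> 0" and q0: "q \<noteq> 0" and k: "k \<ge> 1" and q2k: "q ^ (2*k) \<noteq> 1"
    and rels: "annihilates_rels n k q \<phi>"
begin

abbreviation "Q \<equiv> q ^ k"
abbreviation "R \<equiv> inverse q ^ k"

lemma QR: "Q * R = 1"
  using q0 by (simp add: power_inverse)

text \<open>Up to sign this is the determinant of the two quadratic relations in the unknowns
  \<open>\<psi> \<psi>\<^sup>*\<close> and \<open>\<psi>\<^sup>* \<psi>\<close>. If
  \<open>Q = R\<close>, then \<open>Q * R = 1\<close> becomes \<open>q ^ (2*k) = 1\<close>.\<close>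

lemma Q_neq_R: "Q - R \<noteq> 0"
proof
  assume "Q - R = 0"
  then have "Q * Q = 1" using QR by simp
  then show False using q2k by (simp add: power_mult power2_eq_square flip: power_mult_distrib mult_2 power_add)
qed

lemma rel:
  assumes "lc xs \<in> cl_rels n k q" "valid_word n u" "valid_word n v"
  shows "(\<Sum>(c, w)\<leftarrow>xs. c * \<phi> (u @ w @ v)) = 0"
  using rels assms unfolding annihilates_rels_def by (metis pairing_lc)

lemma rel_pair:
  assumes "a \<in> {1..n}" "b \<in> {1..n}" and uv: "valid_word n u" "valid_word n v"
  shows "\<phi> (u @ Om a # Om b # v) = \<phi> (u @ Om b # Om a # v)"
    "\<phi> (u @ Om a # Psi b # v) = (if a = b then q else 1) * \<phi> (u @ Psi b # Om a # v)"
    "\<phi> (u @ Om a # PsiS b # v) = (if a = b then inverse q else 1) * \<phi> (u @ PsiS b # Om a # v)"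
    "\<phi> (u @ Psi a # Psi b # v) = - \<phi> (u @ Psi b # Psi a # v)"
    "\<phi> (u @ PsiS a # PsiS b # v) = - \<phi> (u @ PsiS b # PsiS a # v)"
    "a \<noteq> b \<Longrightarrow> \<phi> (u @ Psi a # PsiS b # v) = - \<phi> (u @ PsiS b # Psi a # v)"
proof -
  let ?rs = "{ lc [(1, [Om a, Om b]), (-1, [Om b, Om a])],
         lc [(1, [Om a, Psi b]), (- (if a = b then q else 1), [Psi b, Om a])],
         lc [(1, [Om a, PsiS b]), (- (if a = b then inverse q else 1), [PsiS b, Om a])],
         lc [(1, [Psi a, Psi b]), (1, [Psi b, Psi a])],
         lc [(1, [PsiS a, PsiS b]), (1, [PsiS b, PsiS a])] }
       \<union> (if a \<noteq> b then {lc [(1, [Psi a, PsiS b]), (1, [PsiS b, Psi a])]} else {})"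
  have sub: "?rs \<subseteq> cl_rels n k q"
    unfolding cl_rels_def using assms(1,2) by blast
  note r = rel[OF subsetD[OF sub] uv]
  show "\<phi> (u @ Om a # Om b # v) = \<phi> (u @ Om b # Om a # v)"
    using r[of "[(1, [Om a, Om b]), (-1, [Om b, Om a])]"] by simp
  show "\<phi> (u @ Om a # Psi b # v) = (if a = b then q else 1) * \<phi> (u @ Psi b # Om a # v)"
    using r[of "[(1, [Om a, Psi b]), (- (if a = b then q else 1), [Psi b, Om a])]"] by simp
  show "\<phi> (u @ Om a # PsiS b # v) = (if a = b then inverse q else 1) * \<phi> (u @ PsiS b # Om a # v)"
    using r[of "[(1, [Om a, PsiS b]), (- (if a = b then inverse q else 1), [PsiS b, Om a])]"] by simp
  show "\<phi> (u @ Psi a # Psi b # v) = - \<phi> (u @ Psi b # Psi a # v)"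
    using r[of "[(1, [Psi a, Psi b]), (1, [Psi b, Psi a])]"] by (simp add: eq_neg_iff_add_eq_0)
  show "\<phi> (u @ PsiS a # PsiS b # v) = - \<phi> (u @ PsiS b # PsiS a # v)"
    using r[of "[(1, [PsiS a, PsiS b]), (1, [PsiS b, PsiS a])]"] by (simp add: eq_neg_iff_add_eq_0)
  show "\<phi> (u @ Psi a # PsiS b # v) = - \<phi> (u @ PsiS b # Psi a # v)" if "a \<noteq> b"
    using r[of "[(1, [Psi a, PsiS b]), (1, [PsiS b, Psi a])]"] that by (simp add: eq_neg_iff_add_eq_0)
qed

lemma rel_single:
  assumes "a \<in> {1..n}" and uv: "valid_word n u" "valid_word n v"
  shows "\<phi> (u @ Om a # OmI a # v) = \<phi> (u @ v)"
    "\<phi> (u @ OmI a # Om a # v) = \<phi> (u @ v)"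
    "\<phi> (u @ Psi a # PsiS a # v) + Q * \<phi> (u @ PsiS a # Psi a # v) = \<phi> (u @ replicate k (OmI a) @ v)"
    "\<phi> (u @ Psi a # PsiS a # v) + R * \<phi> (u @ PsiS a # Psi a # v) = \<phi> (u @ replicate k (Om a) @ v)"
proof -
  let ?rs = "{ lc [(1, [Om a, OmI a]), (-1, [])],
         lc [(1, [OmI a, Om a]), (-1, [])],
         lc [(1, [Psi a, PsiS a]), (q ^ k, [PsiS a, Psi a]), (-1, replicate k (OmI a))],
         lc [(1, [Psi a, PsiS a]), (inverse q ^ k, [PsiS a, Psi a]), (-1, replicate k (Om a))] }"
  have sub: "?rs \<subseteq> cl_rels n k q"
    unfolding cl_rels_def using assms(1) by blast
  note r = rel[OF subsetD[OF sub] uv]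
  show "\<phi> (u @ Om a # OmI a # v) = \<phi> (u @ v)"
    using r[of "[(1, [Om a, OmI a]), (-1, [])]"] by simp
  show "\<phi> (u @ OmI a # Om a # v) = \<phi> (u @ v)"
    using r[of "[(1, [OmI a, Om a]), (-1, [])]"] by simp
  show "\<phi> (u @ Psi a # PsiS a # v) + Q * \<phi> (u @ PsiS a # Psi a # v) = \<phi> (u @ replicate k (OmI a) @ v)"
    using r[of "[(1, [Psi a, PsiS a]), (q ^ k, [PsiS a, Psi a]), (-1, replicate k (OmI a))]"]
    by (simp add: algebra_simps)
  show "\<phi> (u @ Psi a # PsiS a # v) + R * \<phi> (u @ PsiS a # Psi a # v) = \<phi> (u @ replicate k (Om a) @ v)"
    using r[of "[(1, [Psi a, PsiS a]), (inverse q ^ k, [PsiS a, Psi a]), (-1, replicate k (Om a))]"]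
    by (simp add: algebra_simps)
qed

text \<open>Characteristic different from 2 enters here: anticommutation of a letter with itself
  becomes a vanishing square.\<close>

lemma neg_self_zero: "(x::'k) = - x \<Longrightarrow> x = 0"
  using two by (metis eq_neg_iff_add_eq_0 mult_2 mult_eq_0_iff)

context
  fixes a :: nat
  assumes a: "a \<in> {1..n}"
begin

lemma gidx_a [simp]:
  "gidx (Psi a) \<in> {1..n}" "gidx (PsiS a) \<in> {1..n}" "gidx (Om a) \<in> {1..n}" "gidx (OmI a) \<in> {1..n}"
  using a by auto

lemma psi_sq: "valid_word n u \<Longrightarrow> valid_word n v \<Longrightarrow> \<phi> (u @ Psi a # Psi a # v) = 0"
  using rel_pair(4)[OF a a] neg_self_zero by blast

lemma psiS_sq: "valid_word n u \<Longrightarrow> valid_word n v \<Longrightarrow> \<phi> (u @ PsiS a # PsiS a # v) = 0"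
  using rel_pair(5)[OF a a] neg_self_zero by blast

lemma omI_om_power:
  assumes "valid_word n u" "valid_word n v"
  shows "\<phi> (u @ replicate m (OmI a) @ replicate m (Om a) @ v) = \<phi> (u @ v)"
proof (induction m)
  case (Suc m)
  have "\<phi> (u @ replicate (Suc m) (OmI a) @ replicate (Suc m) (Om a) @ v) =
      \<phi> ((u @ replicate m (OmI a)) @ OmI a # Om a # (replicate m (Om a) @ v))"
    by (simp add: replicate_app_Cons_same)
  also have "\<dots> = \<phi> ((u @ replicate m (OmI a)) @ (replicate m (Om a) @ v))"
    by (rule rel_single) (use assms a in auto)
  finally show ?case using Suc by simp
qed simp

text \<open>\<open>Q\<close> times the relation with \<open>Om\<close> minus \<open>R\<close> times
  the relation with \<open>OmI\<close> eliminates \<open>\<psi>\<^sup>* \<psi>\<close>.\<close>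

lemma psi_psiS:
  assumes "valid_word n u" "valid_word n v"
  shows "(Q - R) * \<phi> (u @ Psi a # PsiS a # v) =
    Q * \<phi> (u @ replicate k (Om a) @ v) - R * \<phi> (u @ replicate k (OmI a) @ v)"
proof -
  have "(s - t) * x = s * (x + t * y) - t * (x + s * y)" for s t x y :: 'k
    by algebra
  then show ?thesis unfolding rel_single(3,4)[OF a assms, symmetric] .
qed

lemma psiS_psi:
  assumes "valid_word n u" "valid_word n v"
  shows "(Q - R) * \<phi> (u @ PsiS a # Psi a # v) =
    \<phi> (u @ replicate k (OmI a) @ v) - \<phi> (u @ replicate k (Om a) @ v)"
proof -
  have "(s - t) * y = (x + s * y) - (x + t * y)" for s t x y :: 'k
    by algebra
  then show ?thesis unfolding rel_single(3,4)[OF a assms, symmetric] .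
qed

text \<open>As \<open>\<psi>\<close> squares to 0, multiplying the formula for
  \<open>\<psi> \<psi>\<^sup>*\<close> by \<open>\<psi>\<close> on the left gives
  \<open>Q \<psi> \<omega>^k = R \<psi> \<omega>^(-k)\<close>. The factor \<open>\<omega>^k\<close>
  in \<open>?v\<close> clears the negative power.\<close>

lemma psi_om_2k:
  assumes "valid_word n u" "valid_word n v"
  shows "\<phi> (u @ Psi a # replicate (2*k) (Om a) @ v) = R * R * \<phi> (u @ Psi a # v)"
proof -
  let ?v = "replicate k (Om a) @ v"
  have "(Q - R) * \<phi> ((u @ [Psi a]) @ Psi a # PsiS a # ?v) =
      Q * \<phi> ((u @ [Psi a]) @ replicate k (Om a) @ ?v) - R * \<phi> ((u @ [Psi a]) @ replicate k (OmI a) @ ?v)"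
    by (rule psi_psiS) (use assms a in auto)
  moreover have "\<phi> ((u @ [Psi a]) @ Psi a # PsiS a # ?v) = 0"
    using psi_sq[of u "PsiS a # ?v"] assms a by simp
  moreover have "\<phi> ((u @ [Psi a]) @ replicate k (OmI a) @ ?v) = \<phi> (u @ Psi a # v)"
    using omI_om_power[of "u @ [Psi a]" v k] assms a by simp
  ultimately have "Q * \<phi> (u @ Psi a # replicate (2*k) (Om a) @ v) = R * \<phi> (u @ Psi a # v)"
    by (simp add: mult_2 replicate_add)
  moreover have "x = t * t * y" if "s * x = t * y" "s * t = 1" for s t x y :: 'k
    using that by algebra
  ultimately show ?thesis using QR by blast
qed

text \<open>The same argument with \<open>\<psi>\<^sup>* \<psi>\<close>, where the two powers of
  \<open>\<omega>\<close> have opposite coefficients, so no scalar appears.\<close>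

lemma psiS_om_2k:
  assumes "valid_word n u" "valid_word n v"
  shows "\<phi> (u @ PsiS a # replicate (2*k) (Om a) @ v) = \<phi> (u @ PsiS a # v)"
proof -
  let ?v = "replicate k (Om a) @ v"
  have "(Q - R) * \<phi> ((u @ [PsiS a]) @ PsiS a # Psi a # ?v) =
      \<phi> ((u @ [PsiS a]) @ replicate k (OmI a) @ ?v) - \<phi> ((u @ [PsiS a]) @ replicate k (Om a) @ ?v)"
    by (rule psiS_psi) (use assms a in auto)
  moreover have "\<phi> ((u @ [PsiS a]) @ PsiS a # Psi a # ?v) = 0"
    using psiS_sq[of u "Psi a # ?v"] assms a by simp
  moreover have "\<phi> ((u @ [PsiS a]) @ replicate k (OmI a) @ ?v) = \<phi> (u @ PsiS a # v)"
    using omI_om_power[of "u @ [PsiS a]" v k] assms a by simp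
  ultimately show ?thesis
    by (simp add: mult_2 replicate_add)
qed

text \<open>By \<open>psiS_om_2k\<close> a factor \<open>\<omega>^(2k)\<close> may be inserted after
  \<open>\<psi> \<psi>\<^sup>*\<close> at no cost. It absorbs the negative power in
  \<open>psi_psiS\<close>.\<close>

lemma psi_psiS_om:
  assumes "valid_word n u" "valid_word n v"
  shows "(Q - R) * \<phi> (u @ Psi a # PsiS a # v) =
    Q * \<phi> (u @ replicate (3*k) (Om a) @ v) - R * \<phi> (u @ replicate k (Om a) @ v)"
proof -
  have three: "3 * k = k + (k + k)" by simp
  have "\<phi> (u @ Psi a # PsiS a # v) = \<phi> (u @ Psi a # PsiS a # replicate (2*k) (Om a) @ v)"
    using psiS_om_2k[of "u @ [Psi a]" v] assms a by simp
  moreover have "(Q - R) * \<phi> (u @ Psi a # PsiS a # replicate (2*k) (Om a) @ v) =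
      Q * \<phi> (u @ replicate k (Om a) @ replicate (2*k) (Om a) @ v)
      - R * \<phi> (u @ replicate k (OmI a) @ replicate (2*k) (Om a) @ v)"
    by (rule psi_psiS) (use assms a in auto)
  moreover have "\<phi> (u @ replicate k (OmI a) @ replicate (2*k) (Om a) @ v) = \<phi> (u @ replicate k (Om a) @ v)"
    using omI_om_power[of u "replicate k (Om a) @ v" k] assms a by (simp add: mult_2 replicate_add)
  ultimately show ?thesis
    unfolding three by (simp add: mult_2 replicate_add)
qed

text \<open>Here the inserted factor follows \<open>\<psi>\<close> and costs the scalar
  \<open>R * R\<close>, which is a unit.\<close>

lemma psiS_psi_om:
  assumes "valid_word n u" "valid_word n v"
  shows "(Q - R) * (R * R * \<phi> (u @ PsiS a # Psi a # v)) =
    \<phi> (u @ replicate k (Om a) @ v) - \<phi> (u @ replicate (3*k) (Om a) @ v)"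
proof -
  have three: "3 * k = k + (k + k)" by simp
  have "R * R * \<phi> (u @ PsiS a # Psi a # v) = \<phi> (u @ PsiS a # Psi a # replicate (2*k) (Om a) @ v)"
    using psi_om_2k[of "u @ [PsiS a]" v] assms a by simp
  moreover have "(Q - R) * \<phi> (u @ PsiS a # Psi a # replicate (2*k) (Om a) @ v) =
      \<phi> (u @ replicate k (OmI a) @ replicate (2*k) (Om a) @ v)
      - \<phi> (u @ replicate k (Om a) @ replicate (2*k) (Om a) @ v)"
    by (rule psiS_psi) (use assms a in auto)
  moreover have "\<phi> (u @ replicate k (OmI a) @ replicate (2*k) (Om a) @ v) = \<phi> (u @ replicate k (Om a) @ v)"
    using omI_om_power[of u "replicate k (Om a) @ v" k] assms a by (simp add: mult_2 replicate_add)
  ultimately show ?thesis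
    unfolding three by (simp add: mult_2 replicate_add)
qed

text \<open>
  The two expressions for \<open>\<psi>\<^sub>a \<psi>\<^sub>a\<^sup>*\<close> differ by \<open>(\<omega>\<^sub>a\<^sup>2\<^sup>k - 1)(q\<^sup>2\<^sup>k \<omega>\<^sub>a\<^sup>2\<^sup>k - 1)\<close> up to a unit.
\<close>

lemma om_4k:
  assumes "valid_word n u" "valid_word n v"
  shows "\<phi> (u @ replicate (4*k) (Om a) @ v) =
    (1 + R * R) * \<phi> (u @ replicate (2*k) (Om a) @ v) - R * R * \<phi> (u @ v)"
proof -
  have four: "4 * k = k + (k + (k + k))" and three: "3 * k = k + (k + k)" by simp_all
  let ?v = "replicate k (Om a) @ v"
  have "Q * \<phi> (u @ replicate k (Om a) @ ?v) - R * \<phi> (u @ replicate k (OmI a) @ ?v) =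
      Q * \<phi> (u @ replicate (3*k) (Om a) @ ?v) - R * \<phi> (u @ replicate k (Om a) @ ?v)"
    using psi_psiS[of u ?v] psi_psiS_om[of u ?v] assms a by simp
  moreover have "\<phi> (u @ replicate k (OmI a) @ ?v) = \<phi> (u @ v)"
    using omI_om_power[of u v k] assms a by simp
  ultimately have *: "Q * \<phi> (u @ replicate (2*k) (Om a) @ v) - R * \<phi> (u @ v) =
      Q * \<phi> (u @ replicate (4*k) (Om a) @ v) - R * \<phi> (u @ replicate (2*k) (Om a) @ v)"
    unfolding four three by (simp add: mult_2 replicate_add)
  have "z = (1 + t * t) * x - t * t * y" if "s * x - t * y = s * z - t * x" "s * t = 1"
    for s t x y z :: 'k
    using that by algebra
  from this[OF * QR] show ?thesis .
qed

text \<open>Appending \<open>\<omega>^(-1)\<close> to the quadratic relation for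
  \<open>\<omega>^(2k)\<close> lowers each positive power by one. Its constant term
  \<open>R * R\<close> is a unit, so \<open>\<omega>^(-1)\<close> becomes a polynomial in
  \<open>\<omega>\<close>.\<close>

lemma omI_as_om:
  assumes "valid_word n u" "valid_word n v"
  shows "R * R * \<phi> (u @ OmI a # v) =
    (1 + R * R) * \<phi> (u @ replicate (2*k - 1) (Om a) @ v) - \<phi> (u @ replicate (4*k - 1) (Om a) @ v)"
proof -
  have drop_om: "\<phi> (u @ replicate m (Om a) @ OmI a # v) = \<phi> (u @ replicate (m - 1) (Om a) @ v)" if "m \<ge> 1" for m
  proof -
    obtain l where l: "m = Suc l" using \<open>m \<ge> 1\<close> by (cases m) auto
    show ?thesis
      using rel_single(1)[OF a, of "u @ replicate l (Om a)" v] assms a unfolding l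
      by (simp flip: replicate_append_same)
  qed
  have "2 * k \<ge> 1" "4 * k \<ge> 1" using k by auto
  then show ?thesis
    using om_4k[of u "OmI a # v"] assms a by (simp add: drop_om)
qed

end

section \<open>Commuting letters of different sites up to a scalar\<close>

lemma commute_letter:
  assumes "gidx g \<in> {1..n}" "gidx h \<in> {1..n}" "gidx g \<noteq> gidx h" "\<forall>b. g \<noteq> OmI b" "\<forall>b. h \<noteq> OmI b"
  shows "\<exists>c. \<forall>u v. valid_word n u \<longrightarrow> valid_word n v \<longrightarrow> \<phi> (u @ g # h # v) = c * \<phi> (u @ h # g # v)"
proof -
  \<comment> \<open>Only the scalars 1 and -1 occur. Each is its own inverse, so \<open>com\<close>
    is symmetric in the letters. \<open>OmI\<close> is excluded since no defining relation moves it
    past another site.\<close>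
  define com where "com c g h \<longleftrightarrow> (\<forall>u v. valid_word n u \<longrightarrow> valid_word n v \<longrightarrow>
      \<phi> (u @ g # h # v) = c * \<phi> (u @ h # g # v))" for c g h
  have "com 1 (Om a) (Om b)" "com 1 (Om a) (Psi b)" "com 1 (Om a) (PsiS b)"
    "com (-1) (Psi a) (Psi b)" "com (-1) (PsiS a) (PsiS b)" "com (-1) (Psi a) (PsiS b)"
    if "a \<in> {1..n}" "b \<in> {1..n}" "a \<noteq> b" for a b
    unfolding com_def using rel_pair[OF that(1,2)] that(3) by simp_all
  moreover have "com 1 h g" if "com 1 g h" for g h
    using that by (simp add: com_def)
  moreover have "com (-1) h g" if "com (-1) g h" for g h
    using that by (simp add: com_def)
  ultimately have "com 1 g h \<or> com (-1) g h"
    using assms by (cases g; cases h) auto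
  then show ?thesis unfolding com_def by blast
qed

lemma commute_word:
  assumes "gidx g \<in> {1..n}" "\<forall>b. g \<noteq> OmI b" "valid_word n X"
    "\<forall>x\<in>set X. gidx x \<noteq> gidx g \<and> (\<forall>b. x \<noteq> OmI b)"
  shows "\<exists>c. \<forall>u v. valid_word n u \<longrightarrow> valid_word n v \<longrightarrow> \<phi> (u @ g # X @ v) = c * \<phi> (u @ X @ g # v)"
  using assms(3,4)
proof (induction X)
  case Nil
  show ?case by (rule exI[of _ 1]) simp
next
  case (Cons h X)
  obtain c where c: "\<And>u v. valid_word n u \<Longrightarrow> valid_word n v \<Longrightarrow> \<phi> (u @ g # X @ v) = c * \<phi> (u @ X @ g # v)"
    using Cons by auto
  have "gidx h \<in> {1..n}" "gidx g \<noteq> gidx h" "\<forall>b. h \<noteq> OmI b" using Cons.prems by auto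
  from commute_letter[OF assms(1) this(1,2) assms(2) this(3)] obtain e
    where e: "\<And>u v. valid_word n u \<Longrightarrow> valid_word n v \<Longrightarrow> \<phi> (u @ g # h # v) = e * \<phi> (u @ h # g # v)"
    by blast
  have "\<phi> (u @ g # (h # X) @ v) = (e * c) * \<phi> (u @ (h # X) @ g # v)"
    if "valid_word n u" "valid_word n v" for u v
    using e[of u "X @ v"] c[of "u @ [h]" v] that Cons.prems by simp
  then show ?case by blast
qed

text \<open>
  Precomposing with left multiplication turns an induction over words, which would need the span
  to be closed under left multiplication, into an induction over all functionals at once.
\<close>

lemma shift_functional:
  assumes "gidx g \<in> {1..n}"
  shows "clifford_functional n k q (\<lambda>w. \<phi> (g # w))"
proof
  show "annihilates_rels n k q (\<lambda>w. \<phi> (g # w))"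
    unfolding annihilates_rels_def
  proof (intro ballI allI impI)
    fix r u v assume "r \<in> cl_rels n k q" "valid_word n u" "valid_word n v"
    with rels assms have "pairing r (\<lambda>w. \<phi> ((g # u) @ w @ v)) = 0"
      unfolding annihilates_rels_def by (metis valid_word_simps(2))
    then show "pairing r (\<lambda>w. \<phi> (g # u @ w @ v)) = 0" by simp
  qed
qed (use two q0 k q2k in auto)

section \<open>Lowering exponents and left multiplication\<close>

lemma kills_ext_if_basis:
  assumes "\<And>p d v. (p, d, v) \<in> basis_idx n k \<Longrightarrow> \<phi> (mono_word n p d v) = 0"
  shows "kills_ext n \<phi>"
proof -
  have "ext_idx n p d v \<Longrightarrow> \<phi> (mono_word n p d v) = 0" for p d v
  \<comment> \<open>The measure is the total degree in \<open>\<omega>\<close>: an exponent beyond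
    its bound is rewritten, at its own site, into strictly smaller ones.\<close>
  proof (induction "\<Sum>a\<in>{1..n}. v a" arbitrary: v rule: less_induct)
    case less
    show ?case
    proof (cases "(p, d, v) \<in> basis_idx n k")
      case False
      then obtain a where a: "a \<in> {1..n}" and big: "v a \<ge> 4*k \<or> (p a + d a = 1 \<and> v a \<ge> 2*k)"
        using ext_idx_basis[OF less.prems k] by blast
      obtain X Y where XY: "valid_word n X" "valid_word n Y"
        and mono: "\<And>i j m. mono_word n (p(a := i)) (d(a := j)) (v(a := m)) =
          X @ replicate i (Psi a) @ replicate j (PsiS a) @ replicate m (Om a) @ Y"
        using mono_word_split[OF a, of p d v] by metis
      have mono': "mono_word n p d (v(a := m)) =
          X @ replicate (p a) (Psi a) @ replicate (d a) (PsiS a) @ replicate m (Om a) @ Y" for m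
        using mono[of "p a" "d a" m] by simp
      have IH: "\<phi> (X @ replicate (p a) (Psi a) @ replicate (d a) (PsiS a) @ replicate m (Om a) @ Y) = 0"
        if "m < v a" for m
      proof -
        have "(\<Sum>b\<in>{1..n}. (v(a := m)) b) < (\<Sum>b\<in>{1..n}. v b)"
          by (rule sum_strict_mono_ex1) (use a that in auto)
        moreover have "ext_idx n p d (v(a := m))"
          using less.prems a by (auto simp: ext_idx_def)
        ultimately show ?thesis using less.hyps mono' by metis
      qed
      have v: "\<phi> (mono_word n p d v) =
          \<phi> (X @ replicate (p a) (Psi a) @ replicate (d a) (PsiS a) @ replicate (v a) (Om a) @ Y)"
        using mono'[of "v a"] by simp
      have "p a + d a < 2" using less.prems a by (auto simp: ext_idx_def)
      then consider "p a = 0" "d a = 0" | "p a = 1" "d a = 0" | "p a = 0" "d a = 1" by linarith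
      then show ?thesis
      proof cases
        case 1
        with big obtain m where m: "v a = 4*k + m" by (auto simp: le_iff_add)
        let ?Y = "replicate m (Om a) @ Y"
        have "\<phi> (X @ replicate (2*k) (Om a) @ ?Y) = 0" "\<phi> (X @ ?Y) = 0"
          using IH[of "2*k + m"] IH[of m] m k 1 by (simp_all add: replicate_add)
        then show ?thesis
          using om_4k[OF a XY(1), of ?Y] XY a unfolding v m by (simp add: 1 replicate_add)
      next
        case 2
        with big obtain m where m: "v a = 2*k + m" by (auto simp: le_iff_add)
        then show ?thesis
          using psi_om_2k[OF a XY(1), of "replicate m (Om a) @ Y"] IH[of m] XY a k unfolding v m
          by (simp add: 2 replicate_add)
      next
        case 3
        with big obtain m where m: "v a = 2*k + m" by (auto simp: le_iff_add)
        then show ?thesis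
          using psiS_om_2k[OF a XY(1), of "replicate m (Om a) @ Y"] IH[of m] XY a k unfolding v m
          by (simp add: 3 replicate_add)
      qed
    qed (use assms in auto)
  qed
  then show ?thesis by (simp add: kills_ext_def)
qed

text \<open>Up to a scalar, \<open>g\<close> passes the blocks of earlier sites and meets the block
  of its own site. There the product vanishes or is a combination of admissible blocks, possibly
  with larger powers of \<open>\<omega>\<close>.\<close>

lemma kills_ext_shift:
  assumes kills: "kills_ext n \<phi>" and a: "gidx g \<in> {1..n}" and g: "\<forall>b. g \<noteq> OmI b" and ext: "ext_idx n p d v"
  shows "\<phi> (g # mono_word n p d v) = 0"
proof -
  define a where "a = gidx g"
  have a': "a \<in> {1..n}" using a by (simp add: a_def)
  obtain X Y where XY: "valid_word n X" "valid_word n Y"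
    and X: "\<forall>x\<in>set X. gidx x \<noteq> a \<and> (\<forall>b. x \<noteq> OmI b)"
    and mono: "\<And>i j m. mono_word n (p(a := i)) (d(a := j)) (v(a := m)) =
          X @ replicate i (Psi a) @ replicate j (PsiS a) @ replicate m (Om a) @ Y"
    using mono_word_split[OF a', of p d v] by metis
  have zero: "\<phi> (X @ replicate i (Psi a) @ replicate j (PsiS a) @ replicate m (Om a) @ Y) = 0"
    if "i + j < 2" for i j m
  proof -
    have "ext_idx n (p(a := i)) (d(a := j)) (v(a := m))"
      using ext a' that by (auto simp: ext_idx_def)
    then show ?thesis using kills mono by (metis kills_ext_def)
  qed
  have zeros: "\<phi> (X @ replicate m (Om a) @ Y) = 0" "\<phi> (X @ Psi a # replicate m (Om a) @ Y) = 0"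
    "\<phi> (X @ PsiS a # replicate m (Om a) @ Y) = 0" for m
    using zero[of 0 0 m] zero[of 1 0 m] zero[of 0 1 m] by simp_all
  let ?s = "replicate (p a) (Psi a) @ replicate (d a) (PsiS a) @ replicate (v a) (Om a)"
  have mono1: "mono_word n p d v = X @ ?s @ Y"
    using mono[of "p a" "d a" "v a"] by simp
  obtain c where c: "\<And>u v. valid_word n u \<Longrightarrow> valid_word n v \<Longrightarrow> \<phi> (u @ g # X @ v) = c * \<phi> (u @ X @ g # v)"
    using commute_word[OF a g XY(1)] X unfolding a_def by blast
  have "\<phi> (g # X @ ?s @ Y) = c * \<phi> (X @ g # ?s @ Y)"
    using c[of "[]" "?s @ Y"] XY a' by simp
  moreover have "\<phi> (X @ g # ?s @ Y) = 0"
  proof -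
    let ?Y = "replicate (v a) (Om a) @ Y"
    have Y: "valid_word n ?Y" using XY a' by simp
    have "p a + d a < 2" using ext a' by (auto simp: ext_idx_def)
    then consider "p a = 0" "d a = 0" | "p a = 1" "d a = 0" | "p a = 0" "d a = 1" by linarith
    then show ?thesis
    proof cases
      case 1
      then show ?thesis using zeros[of "v a"] zeros[of "Suc (v a)"] g by (cases g) (auto simp: a_def)
    next
      case 2
      have "\<phi> (X @ Om a # Psi a # ?Y) = 0"
        using rel_pair(2)[OF a' a' XY(1) Y] zeros(2)[of "Suc (v a)"] by simp
      moreover have "\<phi> (X @ PsiS a # Psi a # ?Y) = 0"
        using psiS_psi_om[OF a' XY(1) Y] zeros(1)[of "k + v a"] zeros(1)[of "3*k + v a"] Q_neq_R q0
        by (simp add: replicate_add)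
      ultimately show ?thesis using psi_sq[OF a' XY(1) Y] g 2 by (cases g) (auto simp: a_def)
    next
      case 3
      have "\<phi> (X @ Om a # PsiS a # ?Y) = 0"
        using rel_pair(3)[OF a' a' XY(1) Y] zeros(3)[of "Suc (v a)"] by simp
      moreover have "\<phi> (X @ Psi a # PsiS a # ?Y) = 0"
        using psi_psiS_om[OF a' XY(1) Y] zeros(1)[of "k + v a"] zeros(1)[of "3*k + v a"] Q_neq_R
        by (simp add: replicate_add)
      ultimately show ?thesis using psiS_sq[OF a' XY(1) Y] g 3 by (cases g) (auto simp: a_def)
    qed
  qed
  ultimately show ?thesis by (simp add: mono1)
qed

end

text \<open>Stated outside the locale because the induction replaces \<open>\<phi>\<close> by its
  shift. It supplies the vanishing of both \<open>\<omega>\<close> powers in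
  \<open>omI_as_om\<close>.\<close>

lemma kills_ext_om_power:
  assumes "clifford_functional n k q \<phi>" "kills_ext n \<phi>" "a \<in> {1..n}" "ext_idx n p d v"
  shows "\<phi> (replicate m (Om a) @ mono_word n p d v) = 0"
  using assms(1,2)
proof (induction m arbitrary: \<phi>)
  case 0
  then show ?case
    using assms(4) by (simp add: kills_ext_def)
next
  case (Suc m)
  interpret clifford_functional n k q \<phi> by fact
  interpret s: clifford_functional n k q "\<lambda>w. \<phi> (Om a # w)"
    by (rule shift_functional) (use assms(3) in simp)
  have "kills_ext n (\<lambda>w. \<phi> (Om a # w))"
    using kills_ext_shift[OF Suc.prems(2), of "Om a"] assms(3) by (simp add: kills_ext_def)
  from Suc.IH[OF s.clifford_functional_axioms this] show ?case by simp
qed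

text \<open>The first letter of the word is absorbed into the functional. For \<open>OmI\<close> the
  shift is controlled by rewriting the letter through positive powers of
  \<open>\<omega>\<close>.\<close>

lemma kills_ext_imp_zero:
  assumes "clifford_functional n k q \<phi>" "kills_ext n \<phi>" "valid_word n w"
  shows "\<phi> w = 0"
  using assms
proof (induction w arbitrary: \<phi>)
  case Nil
  interpret clifford_functional n k q \<phi> by fact
  have "mono_word n (\<lambda>_. 0) (\<lambda>_. 0) (\<lambda>_. 0) = []" by (simp add: mono_word_def)
  moreover have "ext_idx n (\<lambda>_. 0) (\<lambda>_. 0) (\<lambda>_. 0)" by (simp add: ext_idx_def)
  ultimately show ?case using Nil.prems(2) unfolding kills_ext_def by metis
next
  case (Cons g w)
  interpret clifford_functional n k q \<phi> by fact
  have g: "gidx g \<in> {1..n}" using Cons.prems by simp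
  interpret s: clifford_functional n k q "\<lambda>w. \<phi> (g # w)"
    by (rule shift_functional) (use g in simp)
  have "kills_ext n (\<lambda>w. \<phi> (g # w))"
  proof (cases "\<exists>a. g = OmI a")
    case True
    then obtain a where a: "g = OmI a" by blast
    have a': "a \<in> {1..n}" using g a by simp
    have "\<phi> (OmI a # mono_word n p d v) = 0" if "ext_idx n p d v" for p d v
    proof -
      have "valid_word n (mono_word n p d v)" by (auto simp: mono_word_def valid_word_def)
      from omI_as_om[OF a' _ this, of "[]"] show ?thesis
        using kills_ext_om_power[OF Cons.prems(1,2) a' that] q0 by simp
    qed
    then show ?thesis unfolding kills_ext_def a by blast
  next
    case False
    then show ?thesis
      using kills_ext_shift[OF Cons.prems(2) g] by (simp add: kills_ext_def)
  qed
  from Cons.IH[OF s.clifford_functional_axioms this] Cons.prems show ?case by simp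
qed

subsection \<open>The monomial representation\<close>

text \<open>The Jordan-Wigner sign: the parity of the number of occupied sites before
  \<open>a\<close>.\<close>

definition fsign :: "nat \<Rightarrow> nat set \<Rightarrow> 'k::field" where
  "fsign a E = (-1) ^ card (E \<inter> {..<a})"

text \<open>The value of \<open>\<omega>\<close> drops by the factor \<open>inverse q\<close> when a
  site is emptied. Read from left to right, this gives
  \<open>\<omega> \<psi> = q \<psi> \<omega>\<close>.\<close>

fun weight :: "'k::field \<Rightarrow> gen \<Rightarrow> nat set \<Rightarrow> 'k" where
  "weight q (Psi a) E = (if a \<in> E then fsign a E else 0)"
| "weight q (PsiS a) E = (if a \<in> E then 0 else fsign a E)"
| "weight q (Om a) E = (if a \<in> E then 1 else inverse q)"
| "weight q (OmI a) E = (if a \<in> E then 1 else q)"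

text \<open>The shift by \<open>k\<close> on filling makes both \<open>\<psi> \<psi>\<^sup>*\<close>
  and \<open>\<psi>\<^sup>* \<psi>\<close> shift by \<open>k\<close>. Modulo 2k this is the shift of
  \<open>\<omega>^k\<close> and of \<open>\<omega>^(-k)\<close> alike, as the two quadratic
  relations demand.\<close>

fun move :: "nat \<Rightarrow> gen \<Rightarrow> nat set \<times> (nat \<Rightarrow> int) \<Rightarrow> nat set \<times> (nat \<Rightarrow> int)" where
  "move k (Psi a) (E, m) = (E - {a}, m)"
| "move k (PsiS a) (E, m) = (insert a E, m(a := m a + int k))"
| "move k (Om a) (E, m) = (E, m(a := m a + 1))"
| "move k (OmI a) (E, m) = (E, m(a := m a - 1))"

text \<open>
  A state is a pair of the set of occupied sites and a vector of exponents, the latter to be read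
  modulo \<open>2k\<close> (which is enforced by restricting to periodic functions). Words act on functions of
  states, so their letters move the state from left to right; in this transposed picture
  \<open>\<psi>\<^sub>a\<close> empties a site and \<open>\<psi>\<^sub>a\<^sup>*\<close> fills it.
\<close>

fun act :: "nat \<Rightarrow> 'k::field \<Rightarrow> gen list \<Rightarrow> (nat set \<times> (nat \<Rightarrow> int) \<Rightarrow> 'k) \<Rightarrow> nat set \<times> (nat \<Rightarrow> int) \<Rightarrow> 'k" where
  "act k q [] G s = G s"
| "act k q (g # w) G s = weight q g (fst s) * act k q w G (move k g s)"

definition periodic :: "nat \<Rightarrow> (nat set \<times> (nat \<Rightarrow> int) \<Rightarrow> 'k) \<Rightarrow> bool" where
  "periodic k G \<longleftrightarrow> (\<forall>E m m'. (\<forall>a. m a mod (2 * int k) = m' a mod (2 * int k)) \<longrightarrow> G (E, m) = G (E, m'))"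

lemma act_append: "act k q (u @ v) G s = act k q u (act k q v G) s"
  by (induction u arbitrary: s) auto

text \<open>In \<open>u @ w @ v\<close> a relation is tested on \<open>act k q v G\<close> rather
  than on \<open>G\<close>, so periodicity has to survive the trailing word.\<close>

lemma periodic_act:
  assumes "periodic k G"
  shows "periodic k (act k q w G)"
proof (induction w)
  case Nil
  then show ?case using assms by (simp add: periodic_def)
next
  case (Cons g w)
  show ?case
    unfolding periodic_def
  proof (intro allI impI)
    fix E and m m' :: "nat \<Rightarrow> int"
    assume m: "\<forall>a. m a mod (2 * int k) = m' a mod (2 * int k)"
    obtain E1 m1 where 1: "move k g (E, m) = (E1, m1)" by fastforce
    obtain E2 m2 where 2: "move k g (E, m') = (E2, m2)" by fastforce
    have shift: "(m a + c) mod (2 * int k) = (m' a + c) mod (2 * int k)" for a c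
      by (rule mod_add_cong) (use m in auto)
    have shift': "(m a - c) mod (2 * int k) = (m' a - c) mod (2 * int k)" for a c
      by (rule mod_diff_cong) (use m in auto)
    have "E1 = E2" using 1 2 by (cases g) auto
    moreover have "m1 a mod (2 * int k) = m2 a mod (2 * int k)" for a
      using 1 2 m shift shift' by (cases g) auto
    ultimately have "act k q w G (E1, m1) = act k q w G (E2, m2)"
      using Cons unfolding periodic_def by blast
    then show "act k q (g # w) G (E, m) = act k q (g # w) G (E, m')"
      by (simp add: 1 2)
  qed
qed

section \<open>Verification of the defining relations on states\<close>

lemma fsign_sq: "fsign a E * fsign a E = (1::'k::field)"
  by (simp add: fsign_def flip: power_mult_distrib)

lemma fsign_nonzero: "fsign a E \<noteq> (0::'k::field)"
  by (simp add: fsign_def)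

lemma fsign_insert:
  assumes "b \<notin> E"
  shows "fsign a (insert b E) = (if b < a then - fsign a E else (fsign a E :: 'k::field))"
  using assms by (auto simp: fsign_def Int_insert_left)

lemma fsign_remove:
  assumes "b \<in> E"
  shows "fsign a (E - {b}) = (if b < a then - fsign a E else (fsign a E :: 'k::field))"
proof -
  have "fsign a (insert b (E - {b})) = (if b < a then - fsign a (E - {b}) else (fsign a (E - {b}) :: 'k))"
    by (rule fsign_insert) simp
  then show ?thesis using assms by (auto simp: insert_absorb)
qed

lemma act_om_power:
  "act k q (replicate j (Om a)) G (E, m) = (if a \<in> E then 1 else inverse q ^ j) * G (E, m(a := m a + int j))"
  by (induction j arbitrary: m) (auto simp: add.assoc mult.assoc diff_diff_eq)

lemma act_omI_power:
  "act k q (replicate j (OmI a)) G (E, m) = (if a \<in> E then 1 else q ^ j) * G (E, m(a := m a - int j))"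
  by (induction j arbitrary: m) (auto simp: add.assoc mult.assoc diff_diff_eq)

text \<open>Each relation is checked on a single state. Periodicity enters in the two quadratic
  ones, where shifts by \<open>k\<close> and \<open>-k\<close> must agree.\<close>

lemma act_relation:
  assumes "q \<noteq> 0" "periodic k G" "r \<in> cl_rels n k q"
  shows "pairing r (\<lambda>w. act k q w G (E, m)) = 0"
proof -
  let ?P = "\<lambda>xs. pairing (lc xs) (\<lambda>w. act k q w G (E, m)) = 0"
  have half_turn: "G (F, m(a := m a - int k)) = G (F, m(a := m a + int k))" for F a
  proof -
    have "m a - int k = (m a + int k) - 2 * int k" by simp
    then have e: "(m a - int k) mod (2 * int k) = (m a + int k) mod (2 * int k)"
      by (simp only: mod_diff_right_eq minus_mod_self2)
    show ?thesis by (rule assms(2)[unfolded periodic_def, rule_format]) (simp add: e)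
  qed
  have set_swap: "E - {a} - {b} = E - {b} - {a}" "insert a (insert b E) = insert b (insert a E)"
    "a \<noteq> b \<Longrightarrow> insert b (E - {a}) = insert b E - {a}" for a b by auto
  have "?P [(1, [Om a, Om b]), (-1, [Om b, Om a])]" for a b
    by (cases "a = b") (auto simp: pairing_lc fun_upd_twist)
  moreover have "?P [(1, [Om a, Psi b]), (- (if a = b then q else 1), [Psi b, Om a])]" for a b
    using assms(1) by (auto simp: pairing_lc)
  moreover have "?P [(1, [Om a, PsiS b]), (- (if a = b then inverse q else 1), [PsiS b, Om a])]" for a b
    using assms(1) by (cases "a = b") (auto simp: pairing_lc fun_upd_twist add_ac)
  moreover have "?P [(1, [Psi a, Psi b]), (1, [Psi b, Psi a])]" for a b
    using set_swap(1)[of a b] linorder_less_linear[of a b]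
    by (cases "a = b") (auto simp: pairing_lc fsign_remove)
  moreover have "?P [(1, [PsiS a, PsiS b]), (1, [PsiS b, PsiS a])]" for a b
    using set_swap(2)[of a b] linorder_less_linear[of a b]
    by (cases "a = b") (auto simp: pairing_lc fsign_insert fun_upd_twist)
  moreover have "?P [(1, [Psi a, PsiS b]), (1, [PsiS b, Psi a])]" if "a \<noteq> b" for a b
    using set_swap(3)[of a b] linorder_less_linear[of a b] that
    by (auto simp: pairing_lc fsign_insert fsign_remove)
  moreover have "?P [(1, [Om a, OmI a]), (-1, [])]" "?P [(1, [OmI a, Om a]), (-1, [])]" for a
    using assms(1) by (auto simp: pairing_lc)
  moreover have "?P [(1, [Psi a, PsiS a]), (q ^ k, [PsiS a, Psi a]), (-1, replicate k (OmI a))]"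
    "?P [(1, [Psi a, PsiS a]), (inverse q ^ k, [PsiS a, Psi a]), (-1, replicate k (Om a))]" for a
    by (auto simp: pairing_lc act_om_power act_omI_power half_turn fsign_insert fsign_remove
        insert_absorb fsign_sq simp flip: mult.assoc)
  ultimately show ?thesis
    using assms(3) unfolding cl_rels_def by (elim UnE UN_E insertE emptyE) (simp_all split: if_splits)
qed

text \<open>A leading word contributes only a scalar and a change of state, hence the induction on
  \<open>u\<close> over all states.\<close>

lemma act_annihilates:
  assumes "q \<noteq> 0" "periodic k G"
  shows "annihilates_rels n k q (\<lambda>w. act k q w G s)"
  unfolding annihilates_rels_def
proof (intro ballI allI impI)
  fix r u v assume r: "r \<in> cl_rels n k q"
  show "pairing r (\<lambda>w. act k q (u @ w @ v) G s) = 0"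
  proof (induction u arbitrary: s)
    case Nil
    show ?case
      using act_relation[OF assms(1) periodic_act[OF assms(2), of q v] r, of "fst s" "snd s"]
      by (simp add: act_append)
  next
    case (Cons g u)
    have "pairing r (\<lambda>w. c * \<phi> w) = c * pairing r \<phi>" for c \<phi>
      by (simp add: pairing_def sum_distrib_left mult.left_commute)
    then show ?case using Cons by simp
  qed
qed

text \<open>The powers of \<open>\<omega>\<close> act last and see the site as the other letters
  left it: occupied if just filled, or if occupied from the start and not emptied.\<close>

lemma act_site:
  assumes "p a + d a < 2"
  shows "act k q (site_word p d v a) G (E, m) =
    (if (p a = 1 \<longrightarrow> a \<in> E) \<and> (d a = 1 \<longrightarrow> a \<notin> E)
     then (if p a + d a = 0 then 1 else fsign a E) *
       (if d a = 1 \<or> p a = 0 \<and> a \<in> E then 1 else inverse q ^ v a) *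
       G ((if p a = 1 then E - {a} else if d a = 1 then insert a E else E),
          m(a := m a + int (v a + k * d a)))
     else 0)"
proof -
  consider "p a = 0" "d a = 0" | "p a = 1" "d a = 0" | "p a = 0" "d a = 1" using assms by linarith
  then show ?thesis
    by cases (auto simp: site_word_def act_om_power add_ac)
qed

text \<open>The constant \<open>K\<close> collects the fermionic signs. It is chosen before
  \<open>v\<close>, \<open>G\<close> and \<open>m\<close>, which allows monomials with different
  exponents to be compared.\<close>

lemma act_sites:
  assumes "distinct as" "\<forall>a\<in>set as. p a + d a < 2"
  shows "\<exists>K. K \<noteq> 0 \<and> (\<forall>v G m. act k q (concat (map (site_word p d v) as)) G (E, m) =
    (if \<forall>a\<in>set as. (p a = 1 \<longrightarrow> a \<in> E) \<and> (d a = 1 \<longrightarrow> a \<notin> E)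
     then K * (\<Prod>a\<in>set as. if d a = 1 \<or> p a = 0 \<and> a \<in> E then 1 else inverse q ^ v a) *
       G (E - {a\<in>set as. p a = 1} \<union> {a\<in>set as. d a = 1},
          \<lambda>b. m b + (if b \<in> set as then int (v b + k * d b) else 0))
     else 0))"
  using assms
proof (induction as arbitrary: E)
  case Nil
  show ?case by (rule exI[of _ 1]) simp
next
  case (Cons a as)
  have a: "a \<notin> set as" "p a + d a < 2" using Cons.prems by auto
  define E1 where "E1 = (if p a = 1 then E - {a} else if d a = 1 then insert a E else E)"
  obtain K where K: "K \<noteq> 0" and IH: "\<And>v G m. act k q (concat (map (site_word p d v) as)) G (E1, m) =
    (if \<forall>a\<in>set as. (p a = 1 \<longrightarrow> a \<in> E1) \<and> (d a = 1 \<longrightarrow> a \<notin> E1)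
     then K * (\<Prod>a\<in>set as. if d a = 1 \<or> p a = 0 \<and> a \<in> E1 then 1 else inverse q ^ v a) *
       G (E1 - {a\<in>set as. p a = 1} \<union> {a\<in>set as. d a = 1},
          \<lambda>b. m b + (if b \<in> set as then int (v b + k * d b) else 0))
     else 0)"
    using Cons.IH[of E1] Cons.prems by auto
  define S where "S = (if p a + d a = 0 then 1 else fsign a E :: 'a)"
  \<comment> \<open>The first block alters the occupation of \<open>a\<close> alone, so the
    conditions and weights of the remaining sites can be read off from \<open>E\<close>.\<close>
  have E1: "b \<in> E1 \<longleftrightarrow> b \<in> E" if "b \<in> set as" for b
    using that a by (auto simp: E1_def)
  show ?case
  proof (intro exI[of _ "S * K"] conjI allI)
    show "S * K \<noteq> 0" using K by (simp add: S_def fsign_nonzero)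
    fix v G and m :: "nat \<Rightarrow> int"
    let ?ok = "\<lambda>a. (p a = 1 \<longrightarrow> a \<in> E) \<and> (d a = 1 \<longrightarrow> a \<notin> E)"
    let ?f = "\<lambda>a. if d a = 1 \<or> p a = 0 \<and> a \<in> E then 1 else inverse q ^ v a"
    let ?m = "m(a := m a + int (v a + k * d a))"
    let ?E2 = "E - {b\<in>set (a # as). p b = 1} \<union> {b\<in>set (a # as). d b = 1}"
    let ?m2 = "\<lambda>b. m b + (if b \<in> set (a # as) then int (v b + k * d b) else 0)"
    have "act k q (concat (map (site_word p d v) (a # as))) G (E, m) =
        (if ?ok a then S * ?f a * act k q (concat (map (site_word p d v) as)) G (E1, ?m) else 0)"
      using a(2) by (simp add: act_append act_site S_def E1_def)
    also have "act k q (concat (map (site_word p d v) as)) G (E1, ?m) =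
       (if \<forall>b\<in>set as. ?ok b then K * (\<Prod>b\<in>set as. ?f b) *
       G (E1 - {a\<in>set as. p a = 1} \<union> {a\<in>set as. d a = 1},
          \<lambda>b. ?m b + (if b \<in> set as then int (v b + k * d b) else 0)) else 0)"
    proof -
      have "(\<forall>b\<in>set as. (p b = 1 \<longrightarrow> b \<in> E1) \<and> (d b = 1 \<longrightarrow> b \<notin> E1)) = (\<forall>b\<in>set as. ?ok b)"
        using E1 by auto
      moreover have "(\<Prod>b\<in>set as. if d b = 1 \<or> p b = 0 \<and> b \<in> E1 then 1 else inverse q ^ v b) =
          (\<Prod>b\<in>set as. ?f b)"
        by (rule prod.cong) (auto simp: E1)
      ultimately show ?thesis unfolding IH by (simp only:)
    qed
    also have "(\<lambda>b. ?m b + (if b \<in> set as then int (v b + k * d b) else 0)) = ?m2"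
      using a by (auto simp: fun_eq_iff)
    also have "E1 - {a\<in>set as. p a = 1} \<union> {a\<in>set as. d a = 1} = ?E2"
      using a by (auto simp: E1_def)
    finally have step: "act k q (concat (map (site_word p d v) (a # as))) G (E, m) =
       (if ?ok a then S * ?f a * (if \<forall>b\<in>set as. ?ok b then K * (\<Prod>b\<in>set as. ?f b) * G (?E2, ?m2) else 0)
        else 0)" .
    have merge: "(if A then S * x * (if B then K * y * z else 0) else 0) = (if A \<and> B then S * K * (x * y) * z else 0)"
      for A B x y z by simp
    have ball: "(?ok a \<and> (\<forall>b\<in>set as. ?ok b)) = (\<forall>b\<in>set (a # as). ?ok b)"
      by simp
    have prod: "?f a * (\<Prod>b\<in>set as. ?f b) = (\<Prod>b\<in>set (a # as). ?f b)"
      using a(1) by simp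
    show "act k q (concat (map (site_word p d v) (a # as))) G (E, m) =
       (if \<forall>b\<in>set (a # as). ?ok b then S * K * (\<Prod>b\<in>set (a # as). ?f b) * G (?E2, ?m2) else 0)"
      unfolding step merge prod ball ..
  qed
qed

section \<open>Multilinear polynomials vanishing on a two-valued grid\<close>

lemma multilinear_zero:
  fixes c :: "'a set \<Rightarrow> 'k::field"
  assumes "finite U" "\<alpha> \<noteq> \<beta>"
    "\<And>F. F \<subseteq> U \<Longrightarrow> (\<Sum>\<sigma>\<in>Pow U. c \<sigma> * (\<Prod>a\<in>\<sigma>. if a \<in> F then \<alpha> else \<beta>)) = 0"
    "\<sigma> \<subseteq> U"
  shows "c \<sigma> = 0"
  using assms(1,3,4)
proof (induction U arbitrary: c \<sigma> rule: finite_induct)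
  case empty
  then show ?case by simp
next
  case (insert x U)
  have split: "(\<Sum>\<sigma>\<in>Pow (insert x U). c \<sigma> * (\<Prod>a\<in>\<sigma>. if a \<in> F then \<alpha> else \<beta>)) =
      (\<Sum>\<sigma>\<in>Pow U. (c \<sigma> + (if x \<in> F then \<alpha> else \<beta>) * c (insert x \<sigma>)) *
        (\<Prod>a\<in>\<sigma>. if a \<in> F - {x} then \<alpha> else \<beta>))" for F
  proof -
    let ?g = "\<lambda>\<sigma>. c \<sigma> * (\<Prod>a\<in>\<sigma>. if a \<in> F then \<alpha> else \<beta>)"
    have "(\<Sum>\<sigma>\<in>Pow (insert x U). ?g \<sigma>) = (\<Sum>\<sigma>\<in>Pow U. ?g \<sigma>) + (\<Sum>\<sigma>\<in>insert x ` Pow U. ?g \<sigma>)"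
      unfolding Pow_insert by (rule sum.union_disjoint) (use insert.hyps in auto)
    also have "(\<Sum>\<sigma>\<in>insert x ` Pow U. ?g \<sigma>) = (\<Sum>\<sigma>\<in>Pow U. ?g (insert x \<sigma>))"
      by (rule sum.reindex_cong[of "insert x"]) (use insert.hyps in \<open>auto simp: inj_on_def\<close>)
    also have "(\<Sum>\<sigma>\<in>Pow U. ?g \<sigma>) + (\<Sum>\<sigma>\<in>Pow U. ?g (insert x \<sigma>)) = (\<Sum>\<sigma>\<in>Pow U. ?g \<sigma> + ?g (insert x \<sigma>))"
      by (simp add: sum.distrib)
    also have "\<dots> = (\<Sum>\<sigma>\<in>Pow U. (c \<sigma> + (if x \<in> F then \<alpha> else \<beta>) * c (insert x \<sigma>)) *
        (\<Prod>a\<in>\<sigma>. if a \<in> F - {x} then \<alpha> else \<beta>))"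
    proof (rule sum.cong)
      fix \<sigma> assume "\<sigma> \<in> Pow U"
      then have s: "x \<notin> \<sigma>" "finite \<sigma>" using insert.hyps finite_subset by auto
      have "(\<Prod>a\<in>\<sigma>. if a \<in> F then \<alpha> else \<beta>) = (\<Prod>a\<in>\<sigma>. if a \<in> F - {x} then \<alpha> else \<beta>)"
        by (rule prod.cong) (use s in auto)
      moreover have "(\<Prod>a\<in>insert x \<sigma>. if a \<in> F then \<alpha> else \<beta>) =
          (if x \<in> F then \<alpha> else \<beta>) * (\<Prod>a\<in>\<sigma>. if a \<in> F then \<alpha> else \<beta>)"
        using s by simp
      ultimately show "?g \<sigma> + ?g (insert x \<sigma>) = (c \<sigma> + (if x \<in> F then \<alpha> else \<beta>) * c (insert x \<sigma>)) *
        (\<Prod>a\<in>\<sigma>. if a \<in> F - {x} then \<alpha> else \<beta>)"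
        by (simp only: distrib_right mult.assoc mult.left_commute)
    qed simp
    finally show ?thesis .
  qed
  \<comment> \<open>With the variable of \<open>x\<close> set to \<open>y\<close>, the polynomial is
    multilinear over \<open>U\<close>, so the induction hypothesis kills its coefficients. The two
    values of \<open>y\<close> then separate \<open>c \<tau>\<close> from
    \<open>c (insert x \<tau>)\<close>.\<close>
  have *: "c \<tau> + y * c (insert x \<tau>) = 0" if "\<tau> \<subseteq> U" "y = \<alpha> \<or> y = \<beta>" for \<tau> y
  proof (rule insert.IH[OF _ that(1)])
    fix F assume F: "F \<subseteq> U"
    then have "x \<notin> F" using insert.hyps by auto
    then show "(\<Sum>\<sigma>\<in>Pow U. (c \<sigma> + y * c (insert x \<sigma>)) * (\<Prod>a\<in>\<sigma>. if a \<in> F then \<alpha> else \<beta>)) = 0"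
      using that(2) insert.prems(1)[of F] insert.prems(1)[of "insert x F"] F
      unfolding split by auto
  qed
  have zero: "c (insert x \<tau>) = 0" "c \<tau> = 0" if "\<tau> \<subseteq> U" for \<tau>
  proof -
    have "(\<alpha> - \<beta>) * c (insert x \<tau>) = (c \<tau> + \<alpha> * c (insert x \<tau>)) - (c \<tau> + \<beta> * c (insert x \<tau>))"
      by (simp add: left_diff_distrib)
    then have "(\<alpha> - \<beta>) * c (insert x \<tau>) = 0" using *[OF that] by simp
    then show "c (insert x \<tau>) = 0" using assms(2) by simp
    then show "c \<tau> = 0" using *[OF that, of \<alpha>] by simp
  qed
  show ?case
  proof (cases "x \<in> \<sigma>")
    case True
    then show ?thesis
      using zero(1)[of "\<sigma> - {x}"] insert.prems(2) by (auto simp: insert_absorb)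
  next
    case False
    then show ?thesis using zero(2)[of \<sigma>] insert.prems(2) by auto
  qed
qed

subsection \<open>Linear independence and the basis theorem\<close>

lemma act_mono_word:
  assumes "\<forall>a\<in>{1..n}. p a + d a < 2"
  shows "\<exists>K. K \<noteq> 0 \<and> (\<forall>v G m. act k q (mono_word n p d v) G (E, m) =
    (if \<forall>a\<in>{1..n}. (p a = 1 \<longrightarrow> a \<in> E) \<and> (d a = 1 \<longrightarrow> a \<notin> E)
     then K * (\<Prod>a\<in>{1..n}. if d a = 1 \<or> p a = 0 \<and> a \<in> E then 1 else inverse q ^ v a) *
       G (E - {a\<in>{1..n}. p a = 1} \<union> {a\<in>{1..n}. d a = 1},
          \<lambda>b. m b + (if b \<in> {1..n} then int (v b + k * d b) else 0))
     else 0))"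
proof -
  have set: "set [1..<n+1] = {1..n}" by auto
  show ?thesis
    using act_sites[of "[1..<n+1]" p d k q E] assms unfolding set mono_word_sites by (simp only: distinct_upt simp_thms)
qed

lemma finite_basis_idx: "finite (basis_idx n k)"
proof -
  let ?A = "\<lambda>B :: nat set. {f. \<forall>a. (a \<in> {1..n} \<longrightarrow> f a \<in> B) \<and> (a \<notin> {1..n} \<longrightarrow> f a = (0::nat))}"
  have fin: "finite (?A B)" if "finite B" for B
    by (rule finite_set_of_finite_funs) (use that in auto)
  have "finite (?A {0, 1} \<times> ?A {0, 1} \<times> ?A {0..<4*k})"
    by (intro finite_cartesian_product fin) simp_all
  moreover have "basis_idx n k \<subseteq> ?A {0, 1} \<times> ?A {0, 1} \<times> ?A {0..<4*k}"
    unfolding basis_idx_def by blast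
  ultimately show ?thesis by (rule finite_subset[rotated])
qed

lemma basis_idx_site:
  assumes "(p, d, v) \<in> basis_idx n k" "a \<in> {1..n}" "k \<ge> 1"
  shows "p a = 0 \<and> d a = 0 \<or> p a = 1 \<and> d a = 0 \<and> v a < 2*k \<or> p a = 0 \<and> d a = 1 \<and> v a < 2*k" "v a < 4*k"
proof -
  have "p a \<in> {0,1}" "d a \<in> {0,1}" "v a < 4*k" "p a + d a < 2" "p a + d a = 1 \<longrightarrow> v a \<le> 2*k - 1"
    using assms(1,2) unfolding basis_idx_def by auto
  then show "p a = 0 \<and> d a = 0 \<or> p a = 1 \<and> d a = 0 \<and> v a < 2*k \<or> p a = 0 \<and> d a = 1 \<and> v a < 2*k" "v a < 4*k"
    using assms(3) by auto
qed

text \<open>Testing with the indicator of one final state leaves only the monomials that agree with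
  the given one in \<open>p\<close>, \<open>d\<close> and \<open>v\<close> modulo 2k. Varying the
  initial occupation of the sites in \<open>U\<close> yields the grid equations for their
  coefficients.\<close>

lemma basis_independent:
  fixes q :: "'k::field"
  assumes q0: "q \<noteq> 0" and k: "k \<ge> 1" and q2k: "q ^ (2*k) \<noteq> 1"
    and vanish: "\<And>G s. periodic k G \<Longrightarrow>
      (\<Sum>t\<in>basis_idx n k. c t * act k q (case t of (p, d, v) \<Rightarrow> mono_word n p d v) G s) = 0"
    and t0: "(p0, d0, v0) \<in> basis_idx n k"
  shows "c (p0, d0, v0) = (0::'k)"
proof -
  define P where "P = {a\<in>{1..n}. p0 a = 1}"
  define D where "D = {a\<in>{1..n}. d0 a = 1}"
  define U where "U = {a\<in>{1..n}. p0 a = 0 \<and> d0 a = 0}"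
  \<comment> \<open>\<open>r\<close> reduces \<open>v0\<close> modulo 2k; outside \<open>U\<close>
    the exponents are already below 2k. The set \<sigma> in \<open>h\<close> marks the sites of
    \<open>U\<close> whose exponent is at least 2k, and \<open>h\<close> enumerates \<open>T\<close>
    in this way.\<close>
  define r where "r a = (if a \<in> U then v0 a mod (2*k) else v0 a)" for a
  define h where "h \<sigma> = (p0, d0, \<lambda>a. r a + (if a \<in> \<sigma> then 2*k else 0))" for \<sigma>
  define T where "T = {(p, d, v) \<in> basis_idx n k. p = p0 \<and> d = d0 \<and> (\<forall>a. v a mod (2*k) = v0 a mod (2*k))}"
  have b0: "p0 a = 0 \<and> d0 a = 0 \<or> p0 a = 1 \<and> d0 a = 0 \<and> v0 a < 2*k \<or> p0 a = 0 \<and> d0 a = 1 \<and> v0 a < 2*k"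
    "v0 a < 4*k" if "a \<in> {1..n}" for a
    using basis_idx_site[OF t0 that k] by auto
  have out0: "p0 a = 0" "d0 a = 0" "v0 a = 0" if "a \<notin> {1..n}" for a
    using t0 that unfolding basis_idx_def by auto
  have finU: "finite U" by (simp add: U_def)
  have r_less: "r a < 2*k" if "a \<in> {1..n}" for a
    using b0(1)[OF that] that k by (auto simp: r_def U_def)
  have hT: "h \<sigma> \<in> T" if "\<sigma> \<subseteq> U" for \<sigma>
  proof -
    have "r a + (if a \<in> \<sigma> then 2*k else 0) < 4*k" if "a \<in> {1..n}" for a
      using r_less[OF that] by auto
    moreover have "a \<notin> \<sigma>" if "p0 a + d0 a = 1" for a
      using that \<open>\<sigma> \<subseteq> U\<close> by (auto simp: U_def)
    moreover have "r a = 0 \<and> a \<notin> \<sigma>" if "a \<notin> {1..n}" for a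
      using that out0 \<open>\<sigma> \<subseteq> U\<close> by (auto simp: r_def U_def)
    moreover have "r a \<le> 2*k - 1" if "a \<in> {1..n}" for a
      using r_less[OF that] by simp
    ultimately have "h \<sigma> \<in> basis_idx n k"
      using b0 out0 unfolding basis_idx_def h_def by fastforce
    then show ?thesis by (auto simp: T_def h_def r_def)
  qed
  have T_image: "T = h ` Pow U"
  proof
    show "h ` Pow U \<subseteq> T" using hT by auto
    show "T \<subseteq> h ` Pow U"
    proof
      fix t assume "t \<in> T"
      then obtain v where t: "t = (p0, d0, v)" and tb: "(p0, d0, v) \<in> basis_idx n k"
        and cong: "\<And>a. v a mod (2*k) = v0 a mod (2*k)"
        by (auto simp: T_def)
      let ?\<sigma> = "{a\<in>U. v a \<ge> 2*k}"
      have "v a = r a + (if a \<in> ?\<sigma> then 2*k else 0)" for a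
      proof (cases "a \<in> U")
        case True
        then have "v a < 4*k" using tb by (auto simp: U_def basis_idx_def)
        then have "v a = v a mod (2*k) + (if v a \<ge> 2*k then 2*k else 0)"
          by (auto simp: le_mod_geq)
        then show ?thesis using True cong by (simp add: r_def)
      next
        case False
        have "v a = v0 a"
        proof (cases "a \<in> {1..n}")
          case True
          then have "p0 a + d0 a = 1" "v0 a < 2*k" using False b0(1)[OF True] by (auto simp: U_def)
          then have "v a < 2*k" using tb True k unfolding basis_idx_def by fastforce
          then show ?thesis using cong[of a] \<open>v0 a < 2*k\<close> by simp
        next
          case False
          then show ?thesis using tb out0 unfolding basis_idx_def by auto
        qed
        then show ?thesis using False by (simp add: r_def)
      qed
      then have "t = h ?\<sigma>" unfolding t h_def by auto
      then show "t \<in> h ` Pow U" by auto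
    qed
  qed
  have inj: "inj_on h (Pow U)"
  proof (rule inj_onI)
    fix \<sigma> \<tau> assume "h \<sigma> = h \<tau>"
    then have "(if a \<in> \<sigma> then 2*k else 0) = (if a \<in> \<tau> then 2*k else 0)" for a
      by (auto simp: h_def fun_eq_iff)
    then have "a \<in> \<sigma> \<longleftrightarrow> a \<in> \<tau>" for a using k by (metis mult_is_0 not_one_le_zero zero_neq_numeral)
    then show "\<sigma> = \<tau>" by blast
  qed
  have grid: "(\<Sum>\<sigma>\<in>Pow U. c (h \<sigma>) * (\<Prod>a\<in>\<sigma>. if a \<in> F then 1 else inverse q ^ (2*k))) = 0" if F: "F \<subseteq> U" for F
  proof -
    \<comment> \<open>Starting from \<open>F \<union> P\<close>, the sites in \<open>P\<close> are
      emptied and those in \<open>D\<close> filled, so the run ends in \<open>F \<union> D\<close>.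
      On \<open>U\<close> the set \<open>F\<close> is free: \<open>\<omega>^(2k)\<close> has value 1
      on it and \<open>inverse q ^ (2*k)\<close> off it.\<close>
    define G :: "nat set \<times> (nat \<Rightarrow> int) \<Rightarrow> 'k" where
      "G = (\<lambda>(E, m). if E = F \<union> D \<and> (\<forall>a. m a mod (2 * int k) = int (v0 a + k * d0 a) mod (2 * int k)) then 1 else 0)"
    define f where "f v a = (if d0 a = 1 \<or> p0 a = 0 \<and> a \<in> F \<union> P then 1 else inverse q ^ v a)" for v :: "nat \<Rightarrow> nat" and a
    have G: "periodic k G" by (auto simp: periodic_def G_def)
    have FU: "a \<in> {1..n} \<and> p0 a = 0 \<and> d0 a = 0" if "a \<in> F" for a
      using F that by (auto simp: U_def)
    have "\<forall>a\<in>{1..n}. p0 a + d0 a < 2" using b0(1) by fastforce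
    from act_mono_word[OF this, where E = "F \<union> P" and k = k and q = q]
    obtain K where K: "K \<noteq> 0" and act0: "\<And>v G m. act k q (mono_word n p0 d0 v) G (F \<union> P, m) =
      (if \<forall>a\<in>{1..n}. (p0 a = 1 \<longrightarrow> a \<in> F \<union> P) \<and> (d0 a = 1 \<longrightarrow> a \<notin> F \<union> P)
       then K * (\<Prod>a\<in>{1..n}. f v a) *
         G (F \<union> P - {a\<in>{1..n}. p0 a = 1} \<union> {a\<in>{1..n}. d0 a = 1},
            \<lambda>b. m b + (if b \<in> {1..n} then int (v b + k * d0 b) else 0))
       else 0)"
      unfolding f_def by blast
    have ok: "\<forall>a\<in>{1..n}. (p0 a = 1 \<longrightarrow> a \<in> F \<union> P) \<and> (d0 a = 1 \<longrightarrow> a \<notin> F \<union> P)"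
      using b0(1) FU unfolding P_def by fastforce
    have target: "F \<union> P - {a\<in>{1..n}. p0 a = 1} \<union> {a\<in>{1..n}. d0 a = 1} = F \<union> D"
      using FU by (auto simp: P_def D_def)
    have mod_iff: "(\<forall>a. (int (v a) + int (k * d0 a)) mod (2 * int k) = int (v0 a + k * d0 a) mod (2 * int k)) \<longleftrightarrow>
        (\<forall>a. v a mod (2*k) = v0 a mod (2*k))" for v :: "nat \<Rightarrow> nat"
    proof -
      have "(int x + z) mod (2 * int k) = (int y + z) mod (2 * int k) \<longleftrightarrow> x mod (2*k) = y mod (2*k)" for x y z
      proof -
        have "(int x + z) mod (2 * int k) = (int y + z) mod (2 * int k) \<longleftrightarrow> 2 * int k dvd int x - int y"
          by (simp add: mod_eq_dvd_iff)
        also have "\<dots> \<longleftrightarrow> int x mod int (2*k) = int y mod int (2*k)"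
          by (simp add: mod_eq_dvd_iff)
        also have "\<dots> \<longleftrightarrow> x mod (2*k) = y mod (2*k)"
          by (simp only: zmod_int[symmetric] of_nat_eq_iff)
        finally show ?thesis .
      qed
      then show ?thesis by simp
    qed
    have act_value: "act k q (mono_word n p d v) G (F \<union> P, \<lambda>_. 0) =
        (if (p, d, v) \<in> T then K * (\<Prod>a\<in>{1..n}. f v a) else 0)"
      if t: "(p, d, v) \<in> basis_idx n k" for p d v
    proof (cases "p = p0 \<and> d = d0")
      case True
      have "v a = 0" if "a \<notin> {1..n}" for a using t that unfolding basis_idx_def by auto
      then have m: "(\<lambda>b. 0 + (if b \<in> {1..n} then int (v b + k * d0 b) else 0)) = (\<lambda>b. int (v b) + int (k * d0 b))"
        using out0 by (auto simp: fun_eq_iff)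
      have "(p, d, v) \<in> T \<longleftrightarrow> (\<forall>a. v a mod (2*k) = v0 a mod (2*k))"
        using True t by (simp add: T_def)
      moreover have "G (F \<union> D, \<lambda>b. int (v b) + int (k * d0 b)) =
          (if \<forall>a. v a mod (2*k) = v0 a mod (2*k) then 1 else 0)"
        unfolding G_def by (simp only: case_prod_conv mod_iff simp_thms)
      moreover have "act k q (mono_word n p0 d0 v) G (F \<union> P, \<lambda>_. 0) =
          K * (\<Prod>a\<in>{1..n}. f v a) * G (F \<union> D, \<lambda>b. int (v b) + int (k * d0 b))"
        using act0[of v G "\<lambda>_. 0"] unfolding if_P[OF ok] target m .
      ultimately show ?thesis using True by simp
    next
      case False
      have b: "p a + d a < 2" "p a = 0 \<or> p a = 1" "d a = 0 \<or> d a = 1" if "a \<in> {1..n}" for a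
        using t that unfolding basis_idx_def by auto
      have "\<forall>a\<in>{1..n}. p a + d a < 2" using b(1) by auto
      from act_mono_word[OF this, where E = "F \<union> P" and k = k and q = q]
      obtain K' where act': "\<And>v G m. act k q (mono_word n p d v) G (F \<union> P, m) =
        (if \<forall>a\<in>{1..n}. (p a = 1 \<longrightarrow> a \<in> F \<union> P) \<and> (d a = 1 \<longrightarrow> a \<notin> F \<union> P)
         then K' * (\<Prod>a\<in>{1..n}. if d a = 1 \<or> p a = 0 \<and> a \<in> F \<union> P then 1 else inverse q ^ v a) *
           G (F \<union> P - {a\<in>{1..n}. p a = 1} \<union> {a\<in>{1..n}. d a = 1},
              \<lambda>b. m b + (if b \<in> {1..n} then int (v b + k * d b) else 0))
         else 0)"
        by blast
      \<comment> \<open>The changes of occupation between start and end recover \<open>p\<close> and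
        \<open>d\<close>, so any other pair ends in a different state, where \<open>G\<close> is
        0.\<close>
      have "F \<union> P - {a\<in>{1..n}. p a = 1} \<union> {a\<in>{1..n}. d a = 1} \<noteq> F \<union> D"
        if ok': "\<forall>a\<in>{1..n}. (p a = 1 \<longrightarrow> a \<in> F \<union> P) \<and> (d a = 1 \<longrightarrow> a \<notin> F \<union> P)"
      proof
        assume eq: "F \<union> P - {a\<in>{1..n}. p a = 1} \<union> {a\<in>{1..n}. d a = 1} = F \<union> D"
        have "p a = p0 a \<and> d a = d0 a" for a
        proof (cases "a \<in> {1..n}")
          case True
          have "(a \<in> F \<union> P \<and> p a \<noteq> 1 \<or> d a = 1) \<longleftrightarrow> a \<in> F \<union> D"
            using eq True by blast
          then show ?thesis
            using b[OF True] b0(1)[OF True] ok' True FU[of a] by (auto simp: P_def D_def)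
        next
          case False
          then show ?thesis using t out0 unfolding basis_idx_def by auto
        qed
        then have "p = p0 \<and> d = d0" by (simp add: fun_eq_iff)
        then show False using False by simp
      qed
      then have "act k q (mono_word n p d v) G (F \<union> P, \<lambda>_. 0) = 0"
        unfolding act' by (simp add: G_def)
      moreover have "(p, d, v) \<notin> T" using False by (auto simp: T_def)
      ultimately show ?thesis by simp
    qed
    \<comment> \<open>\<open>B\<close> is the nonzero weight of the reduced exponents, common to all
      \<sigma>. The extra 2k at the sites of \<sigma> contributes the remaining product.\<close>
    define B where "B = (\<Prod>a\<in>{1..n}. f r a)"
    have B: "B \<noteq> 0" using q0 by (simp add: B_def f_def)
    have prod_h: "(\<Prod>a\<in>{1..n}. f (\<lambda>a. r a + (if a \<in> \<sigma> then 2*k else 0)) a) =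
        B * (\<Prod>a\<in>\<sigma>. if a \<in> F then 1 else inverse q ^ (2*k))" if "\<sigma> \<subseteq> U" for \<sigma>
    proof -
      have \<sigma>: "a \<in> {1..n} \<and> p0 a = 0 \<and> d0 a = 0 \<and> a \<notin> P" if "a \<in> \<sigma>" for a
        using \<open>\<sigma> \<subseteq> U\<close> that by (auto simp: U_def P_def)
      have "(\<Prod>a\<in>{1..n}. f (\<lambda>a. r a + (if a \<in> \<sigma> then 2*k else 0)) a) =
          (\<Prod>a\<in>{1..n}. f r a * (if a \<in> \<sigma> then (if a \<in> F then 1 else inverse q ^ (2*k)) else 1))"
        by (rule prod.cong) (auto simp: f_def power_add dest: \<sigma>)
      also have "\<dots> = B * (\<Prod>a\<in>{1..n}. if a \<in> \<sigma> then (if a \<in> F then 1 else inverse q ^ (2*k)) else 1)"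
        by (simp add: prod.distrib B_def)
      also have "(\<Prod>a\<in>{1..n}. if a \<in> \<sigma> then (if a \<in> F then 1 else inverse q ^ (2*k)) else 1) =
          (\<Prod>a\<in>\<sigma>. if a \<in> F then 1 else inverse q ^ (2*k))"
        by (rule prod.mono_neutral_cong_right) (use \<sigma> in auto)
      finally show ?thesis .
    qed
    have "0 = (\<Sum>t\<in>basis_idx n k. c t * act k q (case t of (p, d, v) \<Rightarrow> mono_word n p d v) G (F \<union> P, \<lambda>_. 0))"
      using vanish[OF G] by simp
    also have "\<dots> = (\<Sum>t\<in>T. c t * (K * (\<Prod>a\<in>{1..n}. f (snd (snd t)) a)))"
    proof (rule sum.mono_neutral_cong_right)
      show "finite (basis_idx n k)" by (rule finite_basis_idx)
      show T: "T \<subseteq> basis_idx n k" by (auto simp: T_def)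
      show "\<forall>t\<in>basis_idx n k - T.
          c t * act k q (case t of (p, d, v) \<Rightarrow> mono_word n p d v) G (F \<union> P, \<lambda>_. 0) = 0"
        by (auto simp: act_value)
      show "c t * act k q (case t of (p, d, v) \<Rightarrow> mono_word n p d v) G (F \<union> P, \<lambda>_. 0) =
          c t * (K * (\<Prod>a\<in>{1..n}. f (snd (snd t)) a))" if "t \<in> T" for t
        using that subsetD[OF T that] by (cases t) (simp add: act_value)
    qed
    also have "\<dots> = (\<Sum>\<sigma>\<in>Pow U. c (h \<sigma>) * (K * (\<Prod>a\<in>{1..n}. f (snd (snd (h \<sigma>))) a)))"
      unfolding T_image using inj by (simp add: sum.reindex)
    also have "\<dots> = (\<Sum>\<sigma>\<in>Pow U. (K * B) * (c (h \<sigma>) * (\<Prod>a\<in>\<sigma>. if a \<in> F then 1 else inverse q ^ (2*k))))"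
    proof (rule sum.cong)
      fix \<sigma> assume "\<sigma> \<in> Pow U"
      then show "c (h \<sigma>) * (K * (\<Prod>a\<in>{1..n}. f (snd (snd (h \<sigma>))) a)) =
          (K * B) * (c (h \<sigma>) * (\<Prod>a\<in>\<sigma>. if a \<in> F then 1 else inverse q ^ (2*k)))"
        using prod_h[of \<sigma>] by (simp add: h_def)
    qed simp
    also have "\<dots> = (K * B) * (\<Sum>\<sigma>\<in>Pow U. c (h \<sigma>) * (\<Prod>a\<in>\<sigma>. if a \<in> F then 1 else inverse q ^ (2*k)))"
      by (rule sum_distrib_left[symmetric])
    finally show ?thesis using K B by simp
  qed
  have "(p0, d0, v0) \<in> T" using t0 by (simp add: T_def)
  then obtain \<sigma> where \<sigma>: "\<sigma> \<subseteq> U" "(p0, d0, v0) = h \<sigma>" unfolding T_image by auto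
  \<comment> \<open>The two grid values are distinct exactly because
    \<open>q ^ (2*k) \<noteq> 1\<close>.\<close>
  have "(1::'k) \<noteq> inverse q ^ (2*k)"
    using q2k q0 by (simp add: power_inverse)
  from multilinear_zero[OF finU this grid \<sigma>(1)] show ?thesis using \<sigma>(2) by simp
qed

section \<open>Combinations of the monomials modulo the ideal\<close>

lemma cl_ideal_subspace_mod:
  fixes q :: "'k::field" and m :: "'t \<Rightarrow> gen list"
  assumes "finite B"
  shows "word_fun.subspace {f. \<exists>c. (\<lambda>w. f w - (\<Sum>t\<in>B. c t * fa_word (m t) w)) \<in> cl_ideal n k q}"
proof (rule word_fun.subspaceI)
  have "(\<lambda>w. (0 :: gen list \<Rightarrow> 'k) w - (\<Sum>t\<in>B. 0 * fa_word (m t) w)) \<in> cl_ideal n k q"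
    using cl_ideal.zero by simp
  then show "0 \<in> {f. \<exists>c. (\<lambda>w. f w - (\<Sum>t\<in>B. c t * fa_word (m t) w)) \<in> cl_ideal n k q}"
    by (auto intro: exI[of _ "\<lambda>_. 0"])
next
  fix f g :: "gen list \<Rightarrow> 'k"
  assume "f \<in> {f. \<exists>c. (\<lambda>w. f w - (\<Sum>t\<in>B. c t * fa_word (m t) w)) \<in> cl_ideal n k q}"
    and "g \<in> {f. \<exists>c. (\<lambda>w. f w - (\<Sum>t\<in>B. c t * fa_word (m t) w)) \<in> cl_ideal n k q}"
  then obtain c e where "(\<lambda>w. f w - (\<Sum>t\<in>B. c t * fa_word (m t) w)) \<in> cl_ideal n k q"
    "(\<lambda>w. g w - (\<Sum>t\<in>B. e t * fa_word (m t) w)) \<in> cl_ideal n k q" by blast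
  from cl_ideal.add[OF this]
  have "(\<lambda>w. (f + g) w - (\<Sum>t\<in>B. (c t + e t) * fa_word (m t) w)) \<in> cl_ideal n k q"
    by (simp add: fa_add_def sum.distrib distrib_right algebra_simps)
  then show "f + g \<in> {f. \<exists>c. (\<lambda>w. f w - (\<Sum>t\<in>B. c t * fa_word (m t) w)) \<in> cl_ideal n k q}"
    by (auto intro: exI[of _ "\<lambda>t. c t + e t"])
next
  fix x and f :: "gen list \<Rightarrow> 'k"
  assume "f \<in> {f. \<exists>c. (\<lambda>w. f w - (\<Sum>t\<in>B. c t * fa_word (m t) w)) \<in> cl_ideal n k q}"
  then obtain c where "(\<lambda>w. f w - (\<Sum>t\<in>B. c t * fa_word (m t) w)) \<in> cl_ideal n k q" by blast
  from cl_ideal.smul[OF this, of x]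
  have "(\<lambda>w. fa_smul x f w - (\<Sum>t\<in>B. (x * c t) * fa_word (m t) w)) \<in> cl_ideal n k q"
    by (simp add: fa_smul_def right_diff_distrib sum_distrib_left mult.assoc)
  then show "fa_smul x f \<in> {f. \<exists>c. (\<lambda>w. f w - (\<Sum>t\<in>B. c t * fa_word (m t) w)) \<in> cl_ideal n k q}"
    by (auto intro: exI[of _ "\<lambda>t. x * c t"])
qed

theorem theorem3p6:
  fixes q :: "'k::field" and n k :: nat
  assumes "(2::'k) \<noteq> 0" and "q \<noteq> 0" and "n \<ge> 1" and "k \<ge> 1"
    and "q ^ (2*k) \<noteq> 1"
  shows "(\<forall>f\<in>free_alg n. \<exists>c. (\<lambda>w. f w - (\<Sum>t\<in>basis_idx n k.
              c t * fa_word (case t of (p,d,v) \<Rightarrow> mono_word n p d v) w)) \<in> cl_ideal n k q)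
       \<and> (\<forall>c. (\<lambda>w. \<Sum>t\<in>basis_idx n k.
              c t * fa_word (case t of (p,d,v) \<Rightarrow> mono_word n p d v) w) \<in> cl_ideal n k q
            \<longrightarrow> (\<forall>t\<in>basis_idx n k. c t = 0))"
proof -
  define m where "m t = (case t of (p, d, v) \<Rightarrow> mono_word n p d v)" for t
  note fin = finite_basis_idx[of n k]
  \<comment> \<open>\<open>S\<close> is the ideal plus the span of the monomials; an element outside
    it would be separated from it by a linear functional.\<close>
  define S where "S = {f. \<exists>c. (\<lambda>w. f w - (\<Sum>t\<in>basis_idx n k. c t * fa_word (m t) w)) \<in> cl_ideal n k q}"
  have sub: "word_fun.subspace S"
    unfolding S_def by (rule cl_ideal_subspace_mod[OF fin])
  have ideal_S: "f \<in> S" if "f \<in> cl_ideal n k q" for f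
    unfolding S_def using that by (auto intro!: exI[of _ "\<lambda>_. 0"])
  have mono_S: "fa_word (m t) \<in> S" if "t \<in> basis_idx n k" for t
  proof -
    have "(\<Sum>t'\<in>basis_idx n k. (if t' = t then 1 else 0) * fa_word (m t') w) = (fa_word (m t) w :: 'k)" for w
      using that fin by (simp add: if_distrib[of "\<lambda>x. x * _"] cong: if_cong)
    then have "(\<lambda>w. fa_word (m t) w - (\<Sum>t'\<in>basis_idx n k. (if t' = t then 1 else 0) * fa_word (m t') w)) \<in> cl_ideal n k q"
      using cl_ideal.zero[of n k q] by simp
    then show ?thesis unfolding S_def by (intro CollectI exI)
  qed
  have span: "f \<in> S" if f: "f \<in> free_alg n" for f
  proof (rule ccontr)
    assume "f \<notin> S"
    from subspace_separation[OF sub this] obtain L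
      where L: "Vector_Spaces.linear fa_smul (*) L" "\<forall>g\<in>S. L g = 0" "L f = 1" by blast
    \<comment> \<open>\<open>L\<close> vanishes on the ideal and on the monomials, both inside
      \<open>S\<close>. The first gives the relations for \<open>\<phi>\<close>, the second the
      hypothesis of \<open>kills_ext_if_basis\<close>.\<close>
    define \<phi> where "\<phi> w = L (fa_word w)" for w
    have rels: "annihilates_rels n k q \<phi>"
      unfolding annihilates_rels_def
    proof (intro ballI allI impI)
      fix r u v assume r: "r \<in> cl_rels n k q" and uv: "valid_word n u" "valid_word n v"
      let ?g = "fa_mul (fa_mul (fa_word u) r) (fa_word v)"
      obtain xs where "r = lc xs" using r cl_rels_lc by blast
      then have "finite {w. ?g w \<noteq> 0}" by (simp add: finite_support_context finite_support_lc)
      from linear_eq_pairing[OF L(1) this]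
      have "L ?g = pairing r (\<lambda>w. \<phi> (u @ w @ v))"
        by (simp add: pairing_context \<phi>_def)
      moreover have "?g \<in> S" using cl_ideal.gen[OF r uv] by (rule ideal_S)
      ultimately show "pairing r (\<lambda>w. \<phi> (u @ w @ v)) = 0" using L(2) by simp
    qed
    interpret clifford_functional n k q \<phi>
      using assms rels by unfold_locales auto
    have "kills_ext n \<phi>"
    proof (rule kills_ext_if_basis)
      fix p d v assume "(p, d, v) \<in> basis_idx n k"
      then show "\<phi> (mono_word n p d v) = 0" using mono_S L(2) by (force simp: \<phi>_def m_def)
    qed
    then have "\<phi> w = 0" if "valid_word n w" for w
      using kills_ext_imp_zero[OF clifford_functional_axioms] that by blast
    moreover have "L f = pairing f \<phi>"
      using linear_eq_pairing[OF L(1)] f by (simp add: free_alg_def \<phi>_def[abs_def])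
    ultimately have "L f = 0"
      using f by (simp add: pairing_def free_alg_def)
    then show False using L(3) by simp
  qed
  have indep: "c t = 0" if I: "(\<lambda>w. \<Sum>t\<in>basis_idx n k. c t * fa_word (m t) w) \<in> cl_ideal n k q"
    and t: "t \<in> basis_idx n k" for c t
  proof -
    \<comment> \<open>The sum is the pairing of the given ideal element with a functional from the
      representation. Exchanging the sums over words and indices makes this visible.\<close>
    have "(\<Sum>t\<in>basis_idx n k. c t * act k q (m t) G s) = 0" if G: "periodic k G" for G s
    proof -
      let ?f = "\<lambda>w. \<Sum>t\<in>basis_idx n k. c t * fa_word (m t) w"
      let ?A = "m ` basis_idx n k"
      have "pairing ?f (\<lambda>w. act k q w G s) = (\<Sum>w\<in>?A. ?f w * act k q w G s)"
      proof (rule pairing_superset)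
        show "{w. ?f w \<noteq> 0} \<subseteq> ?A"
        proof
          fix w assume "w \<in> {w. ?f w \<noteq> 0}"
          then obtain t where "t \<in> basis_idx n k" "c t * fa_word (m t) w \<noteq> 0"
            by (auto elim: sum.not_neutral_contains_not_neutral)
          then show "w \<in> ?A" by (auto simp: fa_word_def split: if_splits)
        qed
      qed (use fin in auto)
      also have "\<dots> = (\<Sum>t\<in>basis_idx n k. \<Sum>w\<in>?A. c t * fa_word (m t) w * act k q w G s)"
        unfolding sum_distrib_right by (rule sum.swap)
      also have "\<dots> = (\<Sum>t\<in>basis_idx n k. c t * act k q (m t) G s)"
      proof (rule sum.cong)
        fix t assume "t \<in> basis_idx n k"
        have "(\<Sum>w\<in>?A. c t * fa_word (m t) w * act k q w G s) =
            (\<Sum>w\<in>?A. if w = m t then c t * act k q w G s else 0)"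
          by (rule sum.cong) (auto simp: fa_word_def)
        then show "(\<Sum>w\<in>?A. c t * fa_word (m t) w * act k q w G s) = c t * act k q (m t) G s"
          using fin \<open>t \<in> basis_idx n k\<close> by simp
      qed simp
      finally show ?thesis
        using pairing_ideal[OF act_annihilates[OF assms(2) G] I] by simp
    qed
    moreover obtain p d v where "t = (p, d, v)" by (cases t) auto
    ultimately show ?thesis
      using basis_independent[OF assms(2,4,5), where n = n and c = c] t unfolding m_def by blast
  qed
  show ?thesis
    using span indep unfolding S_def m_def by blast
qed

end
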